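(* Let $A\in\mathbb{R}^{n\times n}$, $B\in\mathbb{R}^{n\times m}$, $C\in\mathbb{R}^{p\times n}$, $G=BB^*$, $Q=C^*C$, with $(A,G)$ stabilizable and $(A,Q)$ detectable, and let $\mathcal{H}=\begin{bmatrix} A & G\\ Q & -A^*\end{bmatrix}$. Let $X_k$, $X_k^{\mathsf{adi}}$, $X_k^{\mathsf{cay}}$ be the $k$-th approximations produced by, respectively, the RADI iteration, the quadratic ADI iteration and the Cayley subspace iteration, and let $X_k^{\mathsf{inv}}$ be the approximation produced by the invariant subspace approach (all defined in the context). If the initial approximation in all algorithms is zero, and the same shifts $\sigma_1,\sigma_2,\ldots\in\mathbb{C}_-$ are used, then for all $k$, $$X_k = X_k^{\mathsf{adi}} = X_k^{\mathsf{cay}}.$$ If $\operatorname{rank} C=1$ and the shifts are equal to distinct eigenvalues of $\mathcal{H}$, then for all $k$, $$X_k = X_k^{\mathsf{adi}} = X_k^{\mathsf{cay}} = X_k^{\mathsf{inv}}.$$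
   Context: Notation: $M^*$ is the conjugate transpose, $\operatorname{Re}$ the real part, $\overline{z}$ the complex conjugate; $I$ denotes an identity matrix of suitable size; $\mathbb{C}_-$ is the open left half plane. A matrix is stable if all its eigenvalues lie in $\mathbb{C}_-$. $(A,G)$ is stabilizable if $\operatorname{rank}[A-\lambda I,\ G]=n$ for all $\lambda$ in the closed right half plane; $(A,Q)$ is detectable if $(A^*,Q^* )$ is stabilizable. All the methods approximate the stabilizing solution of the Riccati equation $A^*X+XA+Q-XGX=0$, i.e. the unique positive semidefinite solution $X$ such that $A-GX$ is stable. The shifts $\sigma_k$ are chosen in $\mathbb{C}_-$. RADI iteration: $X_0=0$, $R_0=C^*$, and for $k\ge1$ $$V_k=\sqrt{-2\operatorname{Re}(\sigma_k)}\,(A^*-X_{k-1}BB^*+\sigma_kI)^{-1}R_{k-1},$$ $$\tilde Y_k=I-\tfrac{1}{2\operatorname{Re}(\sigma_k)}(V_k^*B)(V_k^*B)^*,\qquad Y_k=\begin{bmatrix}Y_{k-1}&\\&\tilde Y_k\end{bmatrix},$$ $$R_k=R_{k-1}+\sqrt{-2\operatorname{Re}(\sigma_k)}\,V_k\tilde Y_k^{-1},\qquad Z_k=[Z_{k-1}\ \ V_k],$$ where $Z_0$ and $Y_0$ are empty, and the approximation is $X_k=Z_kY_k^{-1}Z_k^*=X_{k-1}+V_k\tilde Y_k^{-1}V_k^*$. Quadratic ADI iteration: $X_0^{\mathsf{adi}}=0$, and for $k\ge0$ $$X^{\mathsf{adi}}_{k+1/2}(A+\overline{\sigma_{k+1}}I-GX^{\mathsf{adi}}_k)=-Q-(A^*-\overline{\sigma_{k+1}}I)X^{\mathsf{adi}}_k,$$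 $$(A^*+\sigma_{k+1}I-X^{\mathsf{adi}}_{k+1/2}G)X^{\mathsf{adi}}_{k+1}=-Q-X^{\mathsf{adi}}_{k+1/2}(A-\sigma_{k+1}I).$$ Cayley subspace iteration: $X_0^{\mathsf{cay}}=0$, and for $k\ge1$ $$\begin{bmatrix}M_k\\N_k\end{bmatrix}=(\mathcal{H}-\sigma_kI)^{-1}(\mathcal{H}+\overline{\sigma_k}I)\begin{bmatrix}I\\-X^{\mathsf{cay}}_{k-1}\end{bmatrix},\qquad X_k^{\mathsf{cay}}=-N_kM_k^{-1}.$$ Invariant subspace approach: for $1\le k\le n$, let $P_k,Q_k\in\mathbb{C}^{n\times k}$ be such that the columns of $\begin{bmatrix}P_k\\Q_k\end{bmatrix}$ span a $k$-dimensional stable invariant subspace of $\mathcal{H}$, $$\mathcal{H}\begin{bmatrix}P_k\\Q_k\end{bmatrix}=\begin{bmatrix}P_k\\Q_k\end{bmatrix}\Lambda_k,$$ with $\Lambda_k\in\mathbb{C}^{k\times k}$ stable; when compared with the other methods, the eigenvalues of $\Lambda_k$ are the shifts $\sigma_1,\ldots,\sigma_k$. Then $X_k^{\mathsf{inv}}=-Q_k(Q_k^*P_k)^{-1}Q_k^*$.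
   Formalization: Where a shift is an eigenvalue of H, so that (H−σ_k I)^{-1} does not exist, the Cayley step is taken as the limit of its formula for shifts tending to σ_k; RADI is assumed to run for k steps, and for the last equality k≤n and Q_k^*P_k is nonsingular. *)

theory Defs
  imports
    Complex_Main
    "Jordan_Normal_Form.Gauss_Jordan_Elimination"
    "Jordan_Normal_Form.Schur_Decomposition"
    "Jordan_Normal_Form.Spectral_Radius"
    "Jordan_Normal_Form.DL_Rank"
begin

text \<open>
  All matrices are complex; a real matrix is a complex matrix with entries in \<open>\<real>\<close>.
  Shifts are sequences \<open>\<sigma> :: nat \<Rightarrow> complex\<close> of which only the values at \<open>1, 2, \<dots>\<close> are used.
\<close>

definition minv :: "complex mat \<Rightarrow> complex mat" where
  "minv A = the (mat_inverse A)"

definition append_cols :: "complex mat \<Rightarrow> complex mat \<Rightarrow> complex mat" where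
  "append_cols A B = four_block_mat A B (0\<^sub>m 0 (dim_col A)) (0\<^sub>m 0 (dim_col B))"

definition stable_mat :: "complex mat \<Rightarrow> bool" where
  "stable_mat A \<longleftrightarrow> (\<forall>z. eigenvalue A z \<longrightarrow> Re z < 0)"

definition stabilizable :: "complex mat \<Rightarrow> complex mat \<Rightarrow> bool" where
  "stabilizable A G \<longleftrightarrow>
     (\<forall>z. Re z \<ge> 0 \<longrightarrow>
        vec_space.rank (dim_row A) (append_cols (A - z \<cdot>\<^sub>m 1\<^sub>m (dim_row A)) G) = dim_row A)"

definition detectable :: "complex mat \<Rightarrow> complex mat \<Rightarrow> bool" where
  "detectable A Q \<longleftrightarrow> stabilizable (mat_adjoint A) (mat_adjoint Q)"


subsection \<open>RADI iteration\<close>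

definition radi_X :: "complex mat \<Rightarrow> complex mat \<Rightarrow> complex mat" where
  "radi_X Z Y = Z * minv Y * mat_adjoint Z"

definition radi_coeff :: "complex mat \<Rightarrow> complex mat \<Rightarrow> complex \<Rightarrow> complex mat \<Rightarrow> complex mat" where
  "radi_coeff A B s X = mat_adjoint A - X * B * mat_adjoint B + s \<cdot>\<^sub>m 1\<^sub>m (dim_row A)"

text \<open>The state after \<open>k\<close> steps is the triple \<open>(Z\<^sub>k, Y\<^sub>k, R\<^sub>k)\<close>.\<close>

fun radi_state :: "complex mat \<Rightarrow> complex mat \<Rightarrow> complex mat \<Rightarrow> (nat \<Rightarrow> complex) \<Rightarrow> nat
    \<Rightarrow> complex mat \<times> complex mat \<times> complex mat" where
  "radi_state A B C \<sigma> 0 = (0\<^sub>m (dim_row A) 0, 0\<^sub>m 0 0, mat_adjoint C)"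
| "radi_state A B C \<sigma> (Suc k) =
    (let (Z, Y, R) = radi_state A B C \<sigma> k;
         s = \<sigma> (Suc k);
         c = complex_of_real (sqrt (- 2 * Re s));
         V = c \<cdot>\<^sub>m (minv (radi_coeff A B s (radi_X Z Y)) * R);
         W = mat_adjoint V * B;
         Yt = 1\<^sub>m (dim_row C) - complex_of_real (1 / (2 * Re s)) \<cdot>\<^sub>m (W * mat_adjoint W)
     in (append_cols Z V,
         four_block_mat Y (0\<^sub>m (dim_row Y) (dim_col Yt)) (0\<^sub>m (dim_row Yt) (dim_col Y)) Yt,
         R + c \<cdot>\<^sub>m (V * minv Yt)))"

definition radi_approx :: "complex mat \<Rightarrow> complex mat \<Rightarrow> complex mat \<Rightarrow> (nat \<Rightarrow> complex) \<Rightarrow> nat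
    \<Rightarrow> complex mat" where
  "radi_approx A B C \<sigma> k = (let (Z, Y, R) = radi_state A B C \<sigma> k in radi_X Z Y)"

text \<open>
  The first \<open>k\<close> steps can be carried out: every matrix to be inverted for \<open>V\<^sub>1, \<dots>, V\<^sub>k\<close> is
  nonsingular.  No condition on the matrices inverted for \<open>R\<^sub>j\<close> and \<open>X\<^sub>j\<close> is imposed.
\<close>

definition radi_defined :: "complex mat \<Rightarrow> complex mat \<Rightarrow> complex mat \<Rightarrow> (nat \<Rightarrow> complex) \<Rightarrow> nat
    \<Rightarrow> bool" where
  "radi_defined A B C \<sigma> k \<longleftrightarrow>
     (\<forall>j\<in>{1..k}. invertible_mat (radi_coeff A B (\<sigma> j) (radi_approx A B C \<sigma> (j - 1))))"


subsection \<open>Quadratic ADI iteration\<close>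

text \<open>
  Each half step is the unique solution of its linear matrix equation (unspecified if the
  equation is not uniquely solvable).
\<close>

definition adi_half_step :: "complex mat \<Rightarrow> complex mat \<Rightarrow> complex mat \<Rightarrow> complex \<Rightarrow> complex mat
    \<Rightarrow> complex mat" where
  "adi_half_step A G Q s X =
    (let n = dim_row A in
     THE Xh. Xh \<in> carrier_mat n n \<and>
       Xh * (A + cnj s \<cdot>\<^sub>m 1\<^sub>m n - G * X) = - Q - (mat_adjoint A - cnj s \<cdot>\<^sub>m 1\<^sub>m n) * X)"

definition adi_full_step :: "complex mat \<Rightarrow> complex mat \<Rightarrow> complex mat \<Rightarrow> complex \<Rightarrow> complex mat
    \<Rightarrow> complex mat" where
  "adi_full_step A G Q s Xh =
    (let n = dim_row A in
     THE X. X \<in> carrier_mat n n \<and>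
       (mat_adjoint A + s \<cdot>\<^sub>m 1\<^sub>m n - Xh * G) * X = - Q - Xh * (A - s \<cdot>\<^sub>m 1\<^sub>m n))"

fun adi_approx :: "complex mat \<Rightarrow> complex mat \<Rightarrow> complex mat \<Rightarrow> (nat \<Rightarrow> complex) \<Rightarrow> nat
    \<Rightarrow> complex mat" where
  "adi_approx A G Q \<sigma> 0 = 0\<^sub>m (dim_row A) (dim_row A)"
| "adi_approx A G Q \<sigma> (Suc k) =
    adi_full_step A G Q (\<sigma> (Suc k)) (adi_half_step A G Q (\<sigma> (Suc k)) (adi_approx A G Q \<sigma> k))"


subsection \<open>Cayley subspace iteration\<close>

definition cayley_formula :: "nat \<Rightarrow> complex mat \<Rightarrow> complex \<Rightarrow> complex mat \<Rightarrow> complex mat" where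
  "cayley_formula n H s X =
    (let W = minv (H - s \<cdot>\<^sub>m 1\<^sub>m (2 * n)) * (H + cnj s \<cdot>\<^sub>m 1\<^sub>m (2 * n)) * (1\<^sub>m n @\<^sub>r (- X));
         M = mat n n (\<lambda>(i, j). W $$ (i, j));
         N = mat n n (\<lambda>(i, j). W $$ (n + i, j))
     in - (N * minv M))"

text \<open>
  The defining formula makes no sense when the shift is an eigenvalue of \<open>H\<close>, because
  \<open>H - s I\<close> is then singular.  At such shifts the step is taken to be the (entrywise) limit of
  the formula for shifts tending to \<open>s\<close>.
\<close>

definition cayley_step :: "nat \<Rightarrow> complex mat \<Rightarrow> complex \<Rightarrow> complex mat \<Rightarrow> complex mat" where
  "cayley_step n H s X =
    (if eigenvalue H s
     then mat n n (\<lambda>ij. Lim (at s) (\<lambda>z. cayley_formula n H z X $$ ij))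
     else cayley_formula n H s X)"

fun cayley_approx :: "nat \<Rightarrow> complex mat \<Rightarrow> (nat \<Rightarrow> complex) \<Rightarrow> nat \<Rightarrow> complex mat" where
  "cayley_approx n H \<sigma> 0 = 0\<^sub>m n n"
| "cayley_approx n H \<sigma> (Suc k) = cayley_step n H (\<sigma> (Suc k)) (cayley_approx n H \<sigma> k)"


subsection \<open>Invariant subspace approach\<close>

definition stable_invariant_basis ::
    "nat \<Rightarrow> nat \<Rightarrow> complex mat \<Rightarrow> complex mat \<Rightarrow> complex mat \<Rightarrow> complex mat \<Rightarrow> bool" where
  "stable_invariant_basis n k H P Q \<Lambda> \<longleftrightarrow>
     P \<in> carrier_mat n k \<and> Q \<in> carrier_mat n k \<and> \<Lambda> \<in> carrier_mat k k \<and>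
     vec_space.rank (2 * n) (P @\<^sub>r Q) = k \<and>
     H * (P @\<^sub>r Q) = (P @\<^sub>r Q) * \<Lambda> \<and> stable_mat \<Lambda>"

definition inv_approx :: "complex mat \<Rightarrow> complex mat \<Rightarrow> complex mat" where
  "inv_approx P Q = - (Q * minv (mat_adjoint Q * P) * mat_adjoint Q)"

end

theory Submission
  imports Defs
begin

text \<open>
  Write \<open>G = B B\<^sup>*\<close>, \<open>Q = C\<^sup>* C\<close>, and suppose that some Hermitian \<open>X\<close> has the factored Riccati residual
  \<open>A\<^sup>* X + X A + Q - X G X = R R\<^sup>*\<close>.  For a shift \<open>s\<close> put \<open>K = A\<^sup>* - X G + s I\<close>,
  \<open>c\<^sup>2 = - 2 Re s\<close>, \<open>V = c K\<^sup>-\<^sup>1 R\<close> and \<open>Y = I + V\<^sup>* G V / c\<^sup>2\<close>.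
  The matrix \<open>Y\<close> is invertible because it is positive definite
  (\<open>invertible_one_plus_gram\<close>).  The RADI step \<open>X' = X + V Y\<^sup>-\<^sup>1 V\<^sup>*\<close> keeps the residual in factored form, with
  \<open>R' = R + c V Y\<^sup>-\<^sup>1\<close> (\<open>next_residual\<close>), and so the same computation applies at every step.

  The two ADI equations can be solved in these terms.  The half step is \<open>X - R V\<^sup>* / c\<close>, and the
  coefficient of the second equation becomes a low-rank update \<open>Kh\<close> of \<open>K\<close> with
  \<open>Kh V = c R Y\<close>, so that its solution is \<open>X'\<close> (\<open>half_step_eq\<close>, \<open>full_step_eq\<close>, \<open>Kh_invertible\<close>).  For the
  Cayley iteration, the two ADI equations, read in block form, say that
  \<open>(H - s I) [I; - X'] M = (H + cnj s I) [I; - X]\<close> for an invertible \<open>M\<close>, as long as \<open>s\<close> is not an eigenvalue of \<open>H\<close>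
  (\<open>cayley_left\<close>, \<open>cayley_right\<close>).  At an eigenvalue the Cayley step is a limit over shifts
  tending to \<open>s\<close>, and \<open>X'\<close> depends continuously on the shift (\<open>cayley_step\<close>).  Induction over the
  steps gives the equality of the three iterations (\<open>radi_eq_adi_cayley\<close>).

  For the invariant subspace with basis \<open>[P; N]\<close> and \<open>H [P; N] = [P; N] \<Lambda>\<close>, consider the defect
  \<open>X P + N\<close>.  One step multiplies it on the right by
  \<open>(\<Lambda> + cnj s I)\<^sup>-\<^sup>1 (\<Lambda> - s I)\<close>, up to a factor on the left.  If the
  eigenvalues of \<open>\<Lambda>\<close> are the shifts, all of them are removed after \<open>k\<close> steps, whence \<open>X P = - N\<close>
  (\<open>radi_annihilates_stable_subspace\<close>).  If \<open>C\<close> has rank one, each step adds a matrix of rank at most one, so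
  \<open>X = U F\<close> with inner dimension \<open>k\<close> (\<open>radi_approx_low_rank\<close>).  A Hermitian matrix with these two
  properties is \<open>- N (N\<^sup>* P)\<^sup>-\<^sup>1 N\<^sup>*\<close> as soon as \<open>N\<^sup>* P\<close> is invertible (\<open>inv_approx_eq\<close>).
\<close>

section \<open>Matrix algebra, adjoints and inverses\<close>

text \<open>
  The ring laws for rectangular matrices are stated with equations between dimensions as side
  conditions.  In the form with carriers the inner dimension occurs in the premises only and has
  to be guessed; here the simplifier computes both sides of every side condition.  A product is
  thereby expanded into a sum of words, associated to the right, and an identity between such sums
  is closed entry by entry, the entry of each word being an opaque complex number.
\<close>

lemma mat_mult_assoc_dims:
  "dim_col A = dim_row B \<Longrightarrow> dim_col B = dim_row C \<Longrightarrow> (A * B) * C = A * (B * (C :: 'a :: comm_ring_1 mat))"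
  by (rule assoc_mult_mat[of A "dim_row A" "dim_row B" B "dim_row C" C "dim_col C"]) auto

lemma mat_add_mult_dims:
  "dim_row A = dim_row B \<Longrightarrow> dim_col A = dim_col B \<Longrightarrow> dim_col A = dim_row C \<Longrightarrow>
    (A + B) * C = A * C + B * (C :: 'a :: comm_ring_1 mat)"
  by (rule add_mult_distrib_mat[of A "dim_row A" "dim_row C"]) auto

lemma mat_mult_add_dims:
  "dim_row B = dim_row C \<Longrightarrow> dim_col B = dim_col C \<Longrightarrow> dim_col A = dim_row B \<Longrightarrow>
    A * (B + C) = A * B + A * (C :: 'a :: comm_ring_1 mat)"
  by (rule mult_add_distrib_mat[of A "dim_row A" "dim_row C" _ "dim_col C"]) auto

lemma mat_minus_mult_dims:
  "dim_row A = dim_row B \<Longrightarrow> dim_col A = dim_col B \<Longrightarrow> dim_col A = dim_row C \<Longrightarrow>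
    (A - B) * C = A * C - B * (C :: 'a :: comm_ring_1 mat)"
  by (rule minus_mult_distrib_mat[of A "dim_row A" "dim_row C"]) auto

lemma mat_mult_minus_dims:
  "dim_row B = dim_row C \<Longrightarrow> dim_col B = dim_col C \<Longrightarrow> dim_col A = dim_row B \<Longrightarrow>
    A * (B - C) = A * B - A * (C :: 'a :: comm_ring_1 mat)"
  by (rule mult_minus_distrib_mat[of A "dim_row A" "dim_row C" _ "dim_col C"]) auto

lemma mat_mult_smult_dims:
  "dim_col A = dim_row B \<Longrightarrow> A * (c \<cdot>\<^sub>m B) = c \<cdot>\<^sub>m (A * (B :: 'a :: comm_ring_1 mat))"
  by (rule mult_smult_distrib[of A "dim_row A" "dim_row B" B "dim_col B"]) auto

lemma mat_smult_mult_dims: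
  "dim_col A = dim_row B \<Longrightarrow> (c \<cdot>\<^sub>m A) * B = c \<cdot>\<^sub>m (A * (B :: 'a :: comm_ring_1 mat))"
  by (rule mult_smult_assoc_mat[of A "dim_row A" "dim_row B" B "dim_col B"]) auto

lemma mat_uminus_mult_dims:
  "dim_col A = dim_row B \<Longrightarrow> (- A) * B = - (A * (B :: 'a :: comm_ring_1 mat))"
  by (rule uminus_mult_left_mat) auto

lemma mat_mult_uminus_dims:
  "dim_col A = dim_row B \<Longrightarrow> A * (- B) = - (A * (B :: 'a :: comm_ring_1 mat))"
  by (rule uminus_mult_right_mat) auto

lemma mat_one_mult_dims: "dim_row A = n \<Longrightarrow> 1\<^sub>m n * A = (A :: 'a :: comm_ring_1 mat)"
  by (rule left_mult_one_mat') auto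

lemma mat_mult_one_dims: "dim_col A = n \<Longrightarrow> A * 1\<^sub>m n = (A :: 'a :: comm_ring_1 mat)"
  by (rule right_mult_one_mat') auto

lemmas mat_expand = mat_mult_assoc_dims mat_add_mult_dims mat_mult_add_dims
  mat_minus_mult_dims mat_mult_minus_dims mat_mult_smult_dims mat_smult_mult_dims
  mat_uminus_mult_dims mat_mult_uminus_dims mat_one_mult_dims mat_mult_one_dims

lemma mat_adjoint_dims [simp]:
  "dim_row (mat_adjoint A) = dim_col A" "dim_col (mat_adjoint A) = dim_row A"
  by (auto simp: mat_adjoint_def)

lemma mat_adjoint_carrier_iff [simp]: "mat_adjoint A \<in> carrier_mat r c \<longleftrightarrow> A \<in> carrier_mat c r"
  unfolding carrier_mat_def mem_Collect_eq mat_adjoint_dims by (rule conj_commute)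

lemma mat_adjoint_index [simp]:
  "i < dim_col A \<Longrightarrow> j < dim_row A \<Longrightarrow> mat_adjoint (A :: complex mat) $$ (i, j) = cnj (A $$ (j, i))"
  by (simp add: mat_adjoint_def mat_of_rows_index)

lemma mat_adjoint_adjoint [simp]: "mat_adjoint (mat_adjoint A) = (A :: complex mat)"
  by (rule eq_matI) auto

lemma mat_adjoint_add:
  "dim_row A = dim_row B \<Longrightarrow> dim_col A = dim_col B \<Longrightarrow>
    mat_adjoint (A + B) = mat_adjoint A + mat_adjoint (B :: complex mat)"
  by (rule eq_matI) auto

lemma mat_adjoint_minus:
  "dim_row A = dim_row B \<Longrightarrow> dim_col A = dim_col B \<Longrightarrow>
    mat_adjoint (A - B) = mat_adjoint A - mat_adjoint (B :: complex mat)"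
  by (rule eq_matI) auto

lemma mat_adjoint_uminus: "mat_adjoint (- A) = - mat_adjoint (A :: complex mat)"
  by (rule eq_matI) auto

lemma mat_adjoint_smult: "mat_adjoint (c \<cdot>\<^sub>m A) = cnj c \<cdot>\<^sub>m mat_adjoint (A :: complex mat)"
  by (rule eq_matI) auto

lemma mat_adjoint_one: "mat_adjoint (1\<^sub>m n :: complex mat) = 1\<^sub>m n"
  by (rule eq_matI) auto

lemma mat_adjoint_zero: "mat_adjoint (0\<^sub>m n m :: complex mat) = 0\<^sub>m m n"
  by (rule eq_matI) auto

lemma mat_adjoint_mult:
  "dim_col A = dim_row B \<Longrightarrow> mat_adjoint (A * B) = mat_adjoint B * mat_adjoint (A :: complex mat)"
  by (rule eq_matI) (auto simp: scalar_prod_def mult.commute)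

lemmas mat_adjoint_expand = mat_adjoint_add mat_adjoint_minus mat_adjoint_uminus mat_adjoint_smult
  mat_adjoint_one mat_adjoint_zero mat_adjoint_mult

lemma minv_inverse:
  assumes A: "A \<in> carrier_mat n n" and inv: "invertible_mat A"
  shows "minv A \<in> carrier_mat n n" "A * minv A = 1\<^sub>m n" "minv A * A = 1\<^sub>m n"
proof -
  obtain B where AB: "A * B = 1\<^sub>m n" and BA: "B * A = 1\<^sub>m (dim_row B)"
    using inv A unfolding invertible_mat_def inverts_mat_def by auto
  have "dim_col B = n" using arg_cong[OF AB, of dim_col] by simp
  moreover have "dim_row B = n" using arg_cong[OF BA, of dim_col] A by simp
  ultimately have B: "B \<in> carrier_mat n n" by auto
  have "A \<in> Units (ring_mat TYPE(complex) n ())"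
    using A B AB BA by (auto simp: Units_def ring_mat_def)
  then obtain D where D: "mat_inverse A = Some D"
    using mat_inverse(1)[OF A, where b = "()"] by (cases "mat_inverse A") auto
  show "minv A \<in> carrier_mat n n" "A * minv A = 1\<^sub>m n" "minv A * A = 1\<^sub>m n"
    using mat_inverse(2)[OF A D] D by (auto simp: minv_def)
qed

lemma invertible_mat_rightI:
  assumes "A \<in> carrier_mat n n" "B \<in> carrier_mat n n" "A * B = 1\<^sub>m n"
  shows "invertible_mat (A :: complex mat)"
  using assms mat_mult_left_right_inverse[OF assms]
  unfolding invertible_mat_def inverts_mat_def by (auto intro!: exI[of _ B])

lemma minv_unique:
  assumes A: "A \<in> carrier_mat n n" and B: "B \<in> carrier_mat n n" and AB: "A * B = 1\<^sub>m n"
  shows "minv A = B"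
proof -
  note inv = minv_inverse[OF A invertible_mat_rightI[OF assms]]
  have "minv A = minv A * (A * B)" using AB inv(1) by (simp add: mat_expand)
  also have "\<dots> = (minv A * A) * B" using A B inv(1) by (simp add: mat_mult_assoc_dims)
  finally show ?thesis using inv(3) B by simp
qed

lemma mat_adjoint_inverse:
  assumes "A \<in> carrier_mat n n" "invertible_mat A"
  shows "invertible_mat (mat_adjoint A)" "mat_adjoint (minv A) = minv (mat_adjoint A)"
proof -
  note inv = minv_inverse[OF assms]
  have *: "mat_adjoint A * mat_adjoint (minv A) = 1\<^sub>m n"
    using arg_cong[OF inv(3), of mat_adjoint] assms(1) inv(1) by (simp add: mat_adjoint_expand)
  show "invertible_mat (mat_adjoint A)"
    by (rule invertible_mat_rightI[OF _ _ *]) (simp_all add: assms inv)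
  show "mat_adjoint (minv A) = minv (mat_adjoint A)"
    by (rule minv_unique[OF _ _ *, symmetric]) (simp_all add: assms inv)
qed

lemma minv_mult_cancel:
  assumes "A \<in> carrier_mat n n" "invertible_mat A" "dim_row Z = n"
  shows "A * (minv A * Z) = Z" "minv A * (A * Z) = Z"
proof -
  note inv = minv_inverse[OF assms(1,2)]
  have "A * (minv A * Z) = (A * minv A) * Z" "minv A * (A * Z) = (minv A * A) * Z"
    by (rule mat_mult_assoc_dims[symmetric]; use assms inv(1) in auto)+
  then show "A * (minv A * Z) = Z" "minv A * (A * Z) = Z"
    by (simp_all only: inv(2,3) mat_one_mult_dims[OF assms(3)])
qed

lemma invertible_mat_inj:
  assumes A: "A \<in> carrier_mat n n"
    and inj: "\<And>v. v \<in> carrier_vec n \<Longrightarrow> A *\<^sub>v v = 0\<^sub>v n \<Longrightarrow> v = 0\<^sub>v n"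
  shows "invertible_mat (A :: complex mat)"
proof -
  have "det A \<noteq> 0" using inj by (auto simp: det_0_iff_vec_prod_zero[OF A])
  then have "A * ((1 / det A) \<cdot>\<^sub>m adj_mat A) = 1\<^sub>m n"
    using adj_mat[OF A] A by (auto simp: mat_mult_smult_dims intro!: eq_matI)
  then show ?thesis
    using invertible_mat_rightI[OF A, of "(1 / det A) \<cdot>\<^sub>m adj_mat A"] adj_mat(1)[OF A] by simp
qed

lemma invertible_mat_kernel:
  assumes A: "A \<in> carrier_mat n n"
    and inj: "\<And>Z. Z \<in> carrier_mat n 1 \<Longrightarrow> A * Z = 0\<^sub>m n 1 \<Longrightarrow> Z = 0\<^sub>m n 1"
  shows "invertible_mat (A :: complex mat)"
proof (rule invertible_mat_inj[OF A])
  fix v assume v: "v \<in> carrier_vec n" and Av: "A *\<^sub>v v = 0\<^sub>v n"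
  define Z where "Z = mat_of_cols n [v]"
  have Z: "Z \<in> carrier_mat n 1" by (rule carrier_matI) (simp_all add: Z_def)
  have col: "col Z 0 = v" using v by (simp add: Z_def)
  have "A * Z = 0\<^sub>m n 1"
  proof (rule eq_matI)
    fix i j assume ij: "i < dim_row (0\<^sub>m n 1 :: complex mat)" "j < dim_col (0\<^sub>m n 1 :: complex mat)"
    then have "(A * Z) $$ (i, j) = (A *\<^sub>v v) $ i" using A Z col by simp
    then show "(A * Z) $$ (i, j) = 0\<^sub>m n 1 $$ (i, j)" unfolding Av using ij by simp
  qed (use A Z in simp_all)
  then have "Z = 0\<^sub>m n 1" by (rule inj[OF Z])
  then show "v = 0\<^sub>v n" using col by (auto simp: col_def intro!: eq_vecI)
qed

lemma invertible_mat_iff_det: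
  assumes A: "A \<in> carrier_mat n n"
  shows "invertible_mat (A :: complex mat) \<longleftrightarrow> det A \<noteq> 0"
proof
  assume "invertible_mat A"
  then have "det A * det (minv A) = 1"
    using minv_inverse[OF A] by (metis A det_mult det_one)
  then show "det A \<noteq> 0" by auto
next
  assume "det A \<noteq> 0"
  then show "invertible_mat A"
    by (intro invertible_mat_inj[OF A]) (use det_0_iff_vec_prod_zero[OF A] in auto)
qed

text \<open>
  If \<open>v + a W W\<^sup>* v = 0\<close>, then the inner product with \<open>v\<close> gives
  \<open>|v|\<^sup>2 + a |W\<^sup>* v|\<^sup>2 = 0\<close>, and both summands are nonnegative.  Hence the matrices
  \<open>Y\<close> of the RADI iteration are always invertible, so that a RADI step can only break down at
  its shifted linear system.
\<close>

lemma invertible_one_plus_gram: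
  assumes W: "W \<in> carrier_mat p m" and a: "a \<ge> 0"
  shows "invertible_mat (1\<^sub>m p + complex_of_real a \<cdot>\<^sub>m (W * mat_adjoint W))"
proof (rule invertible_mat_inj[of _ p])
  have W': "mat_adjoint W \<in> carrier_mat m p" using W by simp
  fix v :: "complex vec"
  assume v: "v \<in> carrier_vec p"
    and 0: "(1\<^sub>m p + complex_of_real a \<cdot>\<^sub>m (W * mat_adjoint W)) *\<^sub>v v = 0\<^sub>v p"
  define u where "u = mat_adjoint W *\<^sub>v v"
  have u: "u \<in> carrier_vec m"
    unfolding u_def by (rule mult_mat_vec_carrier[OF W' v])
  have Wu: "W *\<^sub>v u \<in> carrier_vec p" by (rule mult_mat_vec_carrier[OF W u])
  have "0\<^sub>v p = v + complex_of_real a \<cdot>\<^sub>v (W *\<^sub>v u)"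
  proof -
    define M where "M = W * mat_adjoint W"
    have M: "M \<in> carrier_mat p p" unfolding M_def by (rule mult_carrier_mat[OF W W'])
    have "M *\<^sub>v v = W *\<^sub>v u"
      unfolding M_def u_def by (rule assoc_mult_mat_vec[OF W W' v])
    moreover have "(complex_of_real a \<cdot>\<^sub>m M) *\<^sub>v v = complex_of_real a \<cdot>\<^sub>v (M *\<^sub>v v)"
      using M v by (intro eq_vecI) (auto simp: scalar_prod_def sum_distrib_left mult_ac)
    moreover have "(1\<^sub>m p + complex_of_real a \<cdot>\<^sub>m M) *\<^sub>v v = v + (complex_of_real a \<cdot>\<^sub>m M) *\<^sub>v v"
      using M v by (subst add_mult_distrib_mat_vec[of _ p p]) auto
    ultimately show ?thesis using 0 unfolding M_def by simp
  qed
  from arg_cong[OF this, of "\<lambda>x. x \<bullet>c v"]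
  have "0 = v \<bullet>c v + complex_of_real a * ((W *\<^sub>v u) \<bullet>c v)"
    using v Wu by (simp add: add_scalar_prod_distrib[of _ p])
  also have "(W *\<^sub>v u) \<bullet>c v = u \<bullet>c u"
  proof -
    have "(W *\<^sub>v u) \<bullet>c v = (\<Sum>i<p. \<Sum>j<m. W $$ (i,j) * u $ j * cnj (v $ i))"
      using W v u by (auto simp: scalar_prod_def sum_distrib_right atLeast0LessThan)
    also have "\<dots> = (\<Sum>j<m. \<Sum>i<p. W $$ (i,j) * u $ j * cnj (v $ i))" by (rule sum.swap)
    also have "\<dots> = (\<Sum>j<m. u $ j * cnj (u $ j))"
      using W v unfolding u_def
      by (auto simp: scalar_prod_def sum_distrib_left atLeast0LessThan mult_ac intro!: sum.cong)
    also have "\<dots> = u \<bullet>c u" using u by (auto simp: scalar_prod_def atLeast0LessThan)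
    finally show ?thesis .
  qed
  finally have eq: "v \<bullet>c v + complex_of_real a * (u \<bullet>c u) = 0" by simp
  moreover have "Re (v \<bullet>c v) \<ge> 0" "Im (v \<bullet>c v) = 0" "Re (u \<bullet>c u) \<ge> 0"
    using conjugate_square_ge_0_vec[of u] conjugate_square_ge_0_vec[of v] u v
    by (auto simp: less_eq_complex_def)
  ultimately have "v \<bullet>c v = 0"
    using add_nonneg_eq_0_iff[of "Re (v \<bullet>c v)" "a * Re (u \<bullet>c u)"] a
    by (auto simp: complex_eq_iff)
  then show "v = 0\<^sub>v p" using v by simp
qed (use W in simp)

section \<open>One RADI step and the Riccati residual\<close>

text \<open>
  The quantities of one step are functions of the shift, the approximation and the
  residual factor, separate from the recursive state, because the continuity argument below moves the shift
  while the other data are fixed.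
\<close>

definition radi_V :: "complex mat \<Rightarrow> complex mat \<Rightarrow> complex \<Rightarrow> complex mat \<Rightarrow> complex mat \<Rightarrow> complex mat" where
  "radi_V A B s X R = complex_of_real (sqrt (- 2 * Re s)) \<cdot>\<^sub>m (minv (radi_coeff A B s X) * R)"

definition radi_Yt :: "nat \<Rightarrow> complex mat \<Rightarrow> complex \<Rightarrow> complex mat \<Rightarrow> complex mat" where
  "radi_Yt p B s V = 1\<^sub>m p - complex_of_real (1 / (2 * Re s)) \<cdot>\<^sub>m
     ((mat_adjoint V * B) * mat_adjoint (mat_adjoint V * B))"

definition radi_next :: "nat \<Rightarrow> complex mat \<Rightarrow> complex mat \<Rightarrow> complex \<Rightarrow> complex mat \<Rightarrow> complex mat \<Rightarrow> complex mat" where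
  "radi_next p A B s X R = (let V = radi_V A B s X R in X + V * minv (radi_Yt p B s V) * mat_adjoint V)"

text \<open>
  The data of one step: a Hermitian \<open>X\<close> whose Riccati residual is factored as
  \<open>R R\<^sup>*\<close>, and a shift \<open>s\<close> in the open left half plane with \<open>K = A\<^sup>* - X B B\<^sup>* + s I\<close>
  invertible.  In the context below, \<open>X'\<close> and \<open>R'\<close> are the next iterate and residual
  factor, and \<open>Xh\<close> and \<open>Kh\<close> are what turns out to be the ADI half step and the matrix
  of the second ADI equation.
\<close>

locale radi_step =
  fixes n m p :: nat and A B Q X R :: "complex mat" and s :: complex
  assumes A: "A \<in> carrier_mat n n" and B: "B \<in> carrier_mat n m" and Q: "Q \<in> carrier_mat n n"
    and X: "X \<in> carrier_mat n n" and R: "R \<in> carrier_mat n p"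
    and herm: "mat_adjoint X = X"
    and residual: "mat_adjoint A * X + X * A + Q - X * (B * mat_adjoint B) * X = R * mat_adjoint R"
    and stable: "Re s < 0"
    and regular: "invertible_mat (radi_coeff A B s X)"
begin

definition "c = complex_of_real (sqrt (- 2 * Re s))"
abbreviation "K \<equiv> radi_coeff A B s X"
abbreviation "V \<equiv> radi_V A B s X R"
abbreviation "Y \<equiv> radi_Yt p B s V"
abbreviation "T \<equiv> minv Y"
abbreviation "X' \<equiv> radi_next p A B s X R"
abbreviation "R' \<equiv> R + c \<cdot>\<^sub>m (V * T)"
abbreviation "Xh \<equiv> X - inverse c \<cdot>\<^sub>m (R * mat_adjoint V)"
abbreviation "Kh \<equiv> mat_adjoint A + s \<cdot>\<^sub>m 1\<^sub>m n - Xh * (B * mat_adjoint B)"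

lemma dims [simp]:
  "dim_row A = n" "dim_col A = n" "dim_row B = n" "dim_col B = m" "dim_row Q = n" "dim_col Q = n"
  "dim_row X = n" "dim_col X = n" "dim_row R = n" "dim_col R = p"
  using A B Q X R by auto

lemma K_carrier: "K \<in> carrier_mat n n"
  by (rule carrier_matI) (simp_all add: radi_coeff_def)

lemma dims_K [simp]: "dim_row K = n" "dim_col K = n"
  using K_carrier by auto

lemma dims_minv_K [simp]: "dim_row (minv K) = n" "dim_col (minv K) = n"
  using minv_inverse(1)[OF K_carrier regular] by auto

lemma V_eq: "V = c \<cdot>\<^sub>m (minv K * R)"
  by (simp add: radi_V_def c_def)

lemma dims_V [simp]: "dim_row V = n" "dim_col V = p"
  by (simp_all add: V_eq)

lemma V_carrier: "V \<in> carrier_mat n p"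
  by (rule carrier_matI) simp_all

lemma dims_Y [simp]: "dim_row Y = p" "dim_col Y = p"
  by (simp_all add: radi_Yt_def)

lemma Y_carrier: "Y \<in> carrier_mat p p"
  by (rule carrier_matI) simp_all

lemma c_real [simp]: "cnj c = c"
  by (simp add: c_def)

lemma c_nonzero [simp]: "c \<noteq> 0"
  using stable by (simp add: c_def)

text \<open>
  All scalars of a step are expressed through \<open>c\<close>; since \<open>c\<^sup>2 = - s - cnj s\<close>, the conjugate of
  the shift can be eliminated, and the entrywise identities become polynomial in \<open>c\<close>, its
  inverse and \<open>s\<close>.
\<close>

lemma c_cancel [simp]: "c * (inverse c * z) = z" "c * (c * (inverse c * inverse c)) = 1"
  by (simp_all flip: mult.assoc)

lemma c_square: "c * c = - s - cnj s"
  using stable by (simp add: c_def complex_eq_iff flip: of_real_mult)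

lemma c_square_Re: "complex_of_real (1 / (2 * Re s)) = - inverse (c * c)"
proof -
  have "c * c = - complex_of_real (2 * Re s)"
    unfolding c_square by (simp add: complex_eq_iff)
  show ?thesis
    unfolding \<open>c * c = - complex_of_real (2 * Re s)\<close> inverse_minus_eq by (simp add: inverse_eq_divide)
qed

lemma cnj_s: "cnj s = - s - c * c"
  by (simp add: c_square)

lemma Y_eq: "Y = 1\<^sub>m p + inverse (c * c) \<cdot>\<^sub>m (mat_adjoint V * (B * (mat_adjoint B * V)))"
  unfolding radi_Yt_def c_square_Re
  by (simp add: mat_expand mat_adjoint_expand)
     (rule eq_matI; simp add: mat_expand del: index_mult_mat(1))

lemma Y_invertible: "invertible_mat Y"
proof -
  have W: "mat_adjoint V * B \<in> carrier_mat p m" by (rule carrier_matI) simp_all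
  have "Y = 1\<^sub>m p + complex_of_real (- 1 / (2 * Re s)) \<cdot>\<^sub>m
      ((mat_adjoint V * B) * mat_adjoint (mat_adjoint V * B))"
    unfolding radi_Yt_def by (rule eq_matI; simp del: index_mult_mat(1))
  moreover have "- 1 / (2 * Re s) \<ge> 0" using stable by (simp add: divide_nonpos_neg)
  ultimately show ?thesis using invertible_one_plus_gram[OF W] by metis
qed

lemma dims_T [simp]: "dim_row T = p" "dim_col T = p"
  using minv_inverse(1)[OF Y_carrier Y_invertible] by auto

lemma T_carrier: "T \<in> carrier_mat p p"
  by (rule carrier_matI) simp_all

lemma Y_herm: "mat_adjoint Y = Y"
  unfolding Y_eq by (simp add: mat_adjoint_expand mat_expand)

lemma T_herm [simp]: "mat_adjoint T = T"
  using mat_adjoint_inverse(2)[OF Y_carrier Y_invertible] Y_herm by simp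

lemma K_V: "K * V = c \<cdot>\<^sub>m R"
  by (simp add: V_eq mat_mult_smult_dims minv_mult_cancel[OF K_carrier regular])

text \<open>
  The defining equation \<open>K V = c R\<close> of \<open>V\<close>, solved for \<open>A\<^sup>* V\<close>.  Read from left to right,
  this equation and its adjoint remove \<open>A\<close> next to \<open>V\<close>; together with the
  definition of \<open>Y\<close>, which replaces \<open>V\<^sup>* B B\<^sup>* V Y\<^sup>-\<^sup>1\<close> by \<open>c\<^sup>2 (I - Y\<^sup>-\<^sup>1)\<close>, they reduce
  the identities of a step to linear combinations of words that cancel.
\<close>

lemma adjA_V: "mat_adjoint A * V = X * (B * (mat_adjoint B * V)) - s \<cdot>\<^sub>m V + c \<cdot>\<^sub>m R"
proof -
  have "mat_adjoint A * V = K * V + X * (B * (mat_adjoint B * V)) - s \<cdot>\<^sub>m V"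
    unfolding radi_coeff_def
    by (simp add: mat_expand) (rule eq_matI; simp del: index_mult_mat(1))
  also have "\<dots> = X * (B * (mat_adjoint B * V)) - s \<cdot>\<^sub>m V + c \<cdot>\<^sub>m R"
    unfolding K_V by (rule eq_matI; simp del: index_mult_mat(1))
  finally show ?thesis .
qed

lemma V_A: "mat_adjoint V * A
    = mat_adjoint V * (B * (mat_adjoint B * X)) - cnj s \<cdot>\<^sub>m mat_adjoint V + c \<cdot>\<^sub>m mat_adjoint R"
  using arg_cong[OF adjA_V, of mat_adjoint] by (simp add: mat_adjoint_expand mat_expand herm)

lemma Y_mult:
  assumes "dim_row Z = p"
  shows "Y * Z = Z + inverse (c * c) \<cdot>\<^sub>m (mat_adjoint V * (B * (mat_adjoint B * (V * Z))))"
  by (subst Y_eq) (simp add: assms mat_expand)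

lemma gram: "mat_adjoint V * (B * (mat_adjoint B * (V * T))) = (c * c) \<cdot>\<^sub>m (1\<^sub>m p - T)"
  unfolding minv_inverse(2)[OF Y_carrier Y_invertible, symmetric] Y_mult[of T, simplified]
  by (rule eq_matI; simp add: algebra_simps del: index_mult_mat(1))

lemma gram_mult:
  assumes "dim_row Z = p"
  shows "mat_adjoint V * (B * (mat_adjoint B * (V * (T * Z)))) = (c * c) \<cdot>\<^sub>m (Z - T * Z)"
  using arg_cong[OF gram, of "\<lambda>M. M * Z"] assms by (simp add: mat_expand)

lemma adjA_V_mult:
  assumes "dim_row Z = p"
  shows "mat_adjoint A * (V * Z) = X * (B * (mat_adjoint B * (V * Z))) - s \<cdot>\<^sub>m (V * Z) + c \<cdot>\<^sub>m (R * Z)"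
  using arg_cong[OF adjA_V, of "\<lambda>M. M * Z"] assms by (simp add: mat_expand)

lemma V_A_mult:
  assumes "dim_row Z = n"
  shows "mat_adjoint V * (A * Z) = mat_adjoint V * (B * (mat_adjoint B * (X * Z)))
    - cnj s \<cdot>\<^sub>m (mat_adjoint V * Z) + c \<cdot>\<^sub>m (mat_adjoint R * Z)"
  using arg_cong[OF V_A, of "\<lambda>M. M * Z"] assms by (simp add: mat_expand)

text \<open>
  The residual equation, solved for \<open>Q\<close>: substituting it is how the factor \<open>R\<close> enters the
  computations below.
\<close>

lemma Q_eq: "Q = R * mat_adjoint R - mat_adjoint A * X - X * A + X * (B * (mat_adjoint B * X))"
  unfolding residual[symmetric]
  by (simp add: mat_expand) (rule eq_matI; simp del: index_mult_mat(1))

lemma next_eq: "X' = X + V * (T * mat_adjoint V)"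
  by (simp add: radi_next_def Let_def mat_expand)

lemma dims_next [simp]: "dim_row X' = n" "dim_col X' = n"
  by (simp_all add: next_eq)

lemma next_carrier: "X' \<in> carrier_mat n n"
  by (rule carrier_matI) simp_all

lemma next_herm: "mat_adjoint X' = X'"
  by (simp add: next_eq mat_adjoint_expand mat_expand herm)

lemmas step_rules = gram gram_mult adjA_V adjA_V_mult V_A V_A_mult

text \<open>
  With \<open>D = V Y\<^sup>-\<^sup>1 V\<^sup>*\<close> the residual changes by \<open>(A\<^sup>* - X B B\<^sup>*) D\<close>, its adjoint and
  \<open>- D B B\<^sup>* D\<close>.  By the rewrite rules these add up to
  \<open>c R Y\<^sup>-\<^sup>1 V\<^sup>* + c V Y\<^sup>-\<^sup>1 R\<^sup>* + c\<^sup>2 V Y\<^sup>-\<^sup>2 V\<^sup>*\<close>, which completes \<open>R R\<^sup>*\<close> to the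
  square \<open>R' R'\<^sup>*\<close>.
\<close>

lemma next_residual:
  "mat_adjoint A * X' + X' * A + Q - X' * (B * mat_adjoint B) * X' = R' * mat_adjoint R'"
  unfolding next_eq
  apply (subst Q_eq)
  apply (simp add: mat_expand step_rules mat_adjoint_expand)
  apply (rule eq_matI; simp add: cnj_s algebra_simps del: index_mult_mat(1))
  done

text \<open>
  Subtracting \<open>X K\<^sup>*\<close> from the right-hand side of the first ADI equation leaves minus the residual
  \<open>R R\<^sup>*\<close>.  As \<open>V\<^sup>* K\<^sup>* = c R\<^sup>*\<close>, the correction to \<open>X\<close> is
  \<open>- R V\<^sup>* / c\<close>, which is \<open>Xh - X\<close>.
\<close>

lemma half_step_eq:
  "Xh * (A + cnj s \<cdot>\<^sub>m 1\<^sub>m n - (B * mat_adjoint B) * X) = - Q - (mat_adjoint A - cnj s \<cdot>\<^sub>m 1\<^sub>m n) * X"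
  apply (subst Q_eq)
  apply (simp add: mat_expand step_rules)
  apply (rule eq_matI; simp add: algebra_simps del: index_mult_mat(1))
  done

text \<open>
  The matrix of the second ADI equation is the rank-\<open>p\<close> update \<open>Kh = K + R V\<^sup>* B B\<^sup>* / c\<close>.
  Therefore \<open>Kh V = c R (I + V\<^sup>* B B\<^sup>* V / c\<^sup>2) = c R Y\<close>: the matrix \<open>Y\<close> of the RADI
  iteration is exactly what relates the two shifted systems.
\<close>

lemma Kh_V_T: "Kh * (V * T) = c \<cdot>\<^sub>m R"
  apply (simp add: mat_expand step_rules)
  apply (rule eq_matI; simp add: algebra_simps del: index_mult_mat(1))
  done

text \<open>
  Relative to \<open>X\<close> the second ADI equation asks for \<open>Kh (X' - X) = c R V\<^sup>*\<close>, which
  the preceding identity solves by \<open>X' - X = V Y\<^sup>-\<^sup>1 V\<^sup>*\<close>.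
\<close>

lemma full_step_eq:
  "Kh * X' = - Q - Xh * (A - s \<cdot>\<^sub>m 1\<^sub>m n)"
  unfolding next_eq
  apply (subst Q_eq)
  apply (simp add: mat_expand step_rules)
  apply (rule eq_matI; simp add: cnj_s algebra_simps del: index_mult_mat(1))
  done

lemma Kh_carrier: "Kh \<in> carrier_mat n n"
  by (rule carrier_matI) simp_all

text \<open>
  The inverse is given explicitly by the Sherman--Morrison--Woodbury formula for the update
  \<open>Kh = K + R V\<^sup>* B B\<^sup>* / c\<close>; it exists because \<open>K\<close> and \<open>Y\<close> are invertible.
\<close>

lemma Kh_invertible: "invertible_mat Kh"
proof -
  define F where "F = (1\<^sub>m n - inverse (c * c) \<cdot>\<^sub>m ((V * T) * (mat_adjoint V * (B * mat_adjoint B))))"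
  have [simp]: "dim_row F = n" "dim_col F = n" by (simp_all add: F_def)
  have "Kh * F = Kh - inverse (c * c) \<cdot>\<^sub>m ((Kh * (V * T)) * (mat_adjoint V * (B * mat_adjoint B)))"
    unfolding F_def by (simp add: mat_expand)
  also have "\<dots> = Kh - inverse c \<cdot>\<^sub>m (R * (mat_adjoint V * (B * mat_adjoint B)))"
    unfolding Kh_V_T
    by (simp add: mat_expand) (rule eq_matI; simp add: algebra_simps del: index_mult_mat(1))
  also have "\<dots> = K"
    unfolding radi_coeff_def
    by (simp add: mat_expand) (rule eq_matI; simp add: algebra_simps del: index_mult_mat(1))
  finally have "Kh * F = K" .
  then have "Kh * (F * minv K) = 1\<^sub>m n"
    using minv_inverse(2)[OF K_carrier regular] by (simp flip: mat_mult_assoc_dims)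
  then show ?thesis
    by (rule invertible_mat_rightI[OF Kh_carrier, rotated]) (rule carrier_matI; simp)
qed

end

section \<open>The quadratic ADI step and the Cayley step\<close>

lemma dims_append_rows [simp]:
  "dim_row (A @\<^sub>r B) = dim_row A + dim_row B" "dim_col (A @\<^sub>r B) = dim_col A"
  by (simp_all add: append_rows_def)

lemma index_append_rows [simp]:
  assumes "i < dim_row A + dim_row B" "j < dim_col A" "dim_col B = dim_col A"
  shows "(A @\<^sub>r B) $$ (i, j) = (if i < dim_row A then A $$ (i, j) else B $$ (i - dim_row A, j))"
  using assms by (auto simp: append_rows_def)

lemma append_rows_mult:
  assumes "dim_col A = dim_row C" "dim_col B = dim_row C"
  shows "(A @\<^sub>r B) * C = (A * C) @\<^sub>r (B * (C :: complex mat))"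
  by (rule eq_matI) (use assms in \<open>auto simp: scalar_prod_def\<close>)

lemma append_rows_minus:
  assumes "dim_row A = dim_row C" "dim_row B = dim_row D"
    "dim_col A = dim_col C" "dim_col B = dim_col C" "dim_col D = dim_col C"
  shows "(A @\<^sub>r B) - (C @\<^sub>r D) = (A - C) @\<^sub>r (B - (D :: complex mat))"
  by (rule eq_matI) (use assms in auto)

lemma append_rows_add:
  assumes "dim_row A = dim_row C" "dim_row B = dim_row D"
    "dim_col A = dim_col C" "dim_col B = dim_col C" "dim_col D = dim_col C"
  shows "(A @\<^sub>r B) + (C @\<^sub>r D) = (A + C) @\<^sub>r (B + (D :: complex mat))"
  by (rule eq_matI) (use assms in auto)

lemma append_rows_smult:
  assumes "dim_col A = dim_col B"
  shows "a \<cdot>\<^sub>m (A @\<^sub>r B) = (a \<cdot>\<^sub>m A) @\<^sub>r (a \<cdot>\<^sub>m (B :: complex mat))"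
  by (rule eq_matI) (use assms in auto)

lemma four_block_mult_append_rows:
  assumes "A \<in> carrier_mat n n" "B \<in> carrier_mat n n" "C \<in> carrier_mat n n" "D \<in> carrier_mat n n"
    and P: "P \<in> carrier_mat n k" and S: "S \<in> carrier_mat n k"
  shows "four_block_mat A B C D * (P @\<^sub>r S) = (A * P + B * S) @\<^sub>r (C * P + D * (S :: complex mat))"
proof -
  have "P @\<^sub>r S = four_block_mat P (0\<^sub>m n 0) S (0\<^sub>m n 0)"
    using P S by (simp add: append_rows_def)
  moreover have "(A * P + B * S) @\<^sub>r (C * P + D * S)
      = four_block_mat (A * P + B * S) (A * 0\<^sub>m n 0 + B * 0\<^sub>m n 0) (C * P + D * S) (C * 0\<^sub>m n 0 + D * 0\<^sub>m n 0)"
    using assms by (simp add: append_rows_def)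
  ultimately show ?thesis
    using mult_four_block_mat[OF assms(1-4) P zero_carrier_mat S zero_carrier_mat, of 0] by simp
qed

lemma mat_mult_left_cancel:
  assumes "M \<in> carrier_mat n n" "invertible_mat M" "dim_row Z = n" "dim_row Z' = n" "M * Z = M * (Z' :: complex mat)"
  shows "Z = Z'"
  using arg_cong[OF assms(5), of "\<lambda>x. minv M * x"]
  by (simp only: minv_mult_cancel[OF assms(1,2,3)] minv_mult_cancel[OF assms(1,2,4)])

lemma mat_mult_right_cancel:
  assumes M: "M \<in> carrier_mat n n" and "invertible_mat M" and Z: "dim_col Z = n" "dim_col Z' = n"
    and eq: "Z * M = Z' * (M :: complex mat)"
  shows "Z = Z'"
proof -
  note inv = minv_inverse[OF assms(1,2)]
  have *: "(W * M) * minv M = W" if "dim_col W = n" for W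
    using that inv M by (simp add: mat_mult_assoc_dims mat_mult_one_dims)
  show ?thesis using arg_cong[OF eq, of "\<lambda>x. x * minv M"] by (simp only: *[OF Z(1)] *[OF Z(2)])
qed

lemma shifted_invertible:
  assumes H: "(H :: complex mat) \<in> carrier_mat N N" and "\<not> eigenvalue H s"
  shows "invertible_mat (H - s \<cdot>\<^sub>m 1\<^sub>m N)"
proof -
  have "H - s \<cdot>\<^sub>m 1\<^sub>m N = char_matrix H s"
    unfolding char_matrix_def using H by (intro eq_matI) auto
  moreover have "char_matrix H s \<in> carrier_mat N N" using H by simp
  ultimately show ?thesis
    using assms(2) eigenvalue_det[OF H] by (simp add: invertible_mat_iff_det)
qed

context radi_step begin

abbreviation "G \<equiv> B * mat_adjoint B"
abbreviation "H \<equiv> four_block_mat A G Q (- mat_adjoint A)"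

lemma adjoint_K: "mat_adjoint K = A + cnj s \<cdot>\<^sub>m 1\<^sub>m n - G * X"
  unfolding radi_coeff_def
  by (simp add: mat_adjoint_expand herm mat_expand)
     (rule eq_matI; simp add: algebra_simps del: index_mult_mat(1))

lemma adj_K_invertible: "invertible_mat (mat_adjoint K)"
  by (rule mat_adjoint_inverse(1)[OF K_carrier regular])

lemma adj_K_carrier: "mat_adjoint K \<in> carrier_mat n n"
  using K_carrier by simp

text \<open>
  Both ADI equations have nonsingular coefficient matrices, \<open>K\<^sup>*\<close> and \<open>Kh\<close>, so the solutions
  found above are the unique ones that the iteration selects.
\<close>

lemma adi_half_step: "adi_half_step A G Q s X = Xh"
proof -
  have eq: "Xh * mat_adjoint K = - Q - (mat_adjoint A - cnj s \<cdot>\<^sub>m 1\<^sub>m n) * X"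
    unfolding adjoint_K by (rule half_step_eq)
  have "Z = Xh" if "Z \<in> carrier_mat n n"
    "Z * mat_adjoint K = - Q - (mat_adjoint A - cnj s \<cdot>\<^sub>m 1\<^sub>m n) * X" for Z
    by (rule mat_mult_right_cancel[OF adj_K_carrier adj_K_invertible, of Z Xh]) (use that in \<open>simp_all add: eq\<close>)
  moreover have "Xh \<in> carrier_mat n n" by (rule carrier_matI) simp_all
  ultimately show ?thesis
    unfolding adi_half_step_def Let_def dims adjoint_K[symmetric]
    using eq by (intro the_equality) blast+
qed

lemma adi_step: "adi_full_step A G Q s (adi_half_step A G Q s X) = X'"
proof -
  have "Z = X'" if "Z \<in> carrier_mat n n"
    "Kh * Z = - Q - Xh * (A - s \<cdot>\<^sub>m 1\<^sub>m n)" for Z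
    by (rule mat_mult_left_cancel[OF Kh_carrier Kh_invertible, of Z X']) (use that in \<open>simp_all add: full_step_eq\<close>)
  then show ?thesis
    unfolding adi_full_step_def Let_def dims adi_half_step
    using full_step_eq next_carrier by (intro the_equality) blast+
qed

abbreviation "S \<equiv> A - G * X' - s \<cdot>\<^sub>m 1\<^sub>m n"

lemma G_carrier: "G \<in> carrier_mat n n"
  by (rule carrier_matI) simp_all

lemma H_carrier: "H \<in> carrier_mat (2 * n) (2 * n)"
  by (rule carrier_matI) simp_all

lemma H_graph:
  assumes Z: "Z \<in> carrier_mat n n"
  shows "H * (1\<^sub>m n @\<^sub>r (- Z)) = (A - G * Z) @\<^sub>r (Q + mat_adjoint A * Z)"
proof -
  have *: "- mat_adjoint A \<in> carrier_mat n n" "- Z \<in> carrier_mat n n" using A Z by simp_all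
  have [simp]: "dim_row Z = n" "dim_col Z = n" using Z by auto
  have "A * 1\<^sub>m n + G * - Z = A - G * Z" "Q * 1\<^sub>m n + - mat_adjoint A * - Z = Q + mat_adjoint A * Z"
    by (simp_all add: mat_expand) (rule eq_matI; simp del: index_mult_mat(1))+
  then show ?thesis
    using four_block_mult_append_rows[OF A G_carrier Q *(1) one_carrier_mat *(2)] by simp
qed

text \<open>
  Both ADI equations say that two block columns are annihilated by the row \<open>[Xh  I]\<close>, that is,
  they are multiples of the block column with entries \<open>I\<close> and \<open>- Xh\<close>.  For the
  second equation this block column is \<open>H - s I\<close> applied to the graph of \<open>- X'\<close>, for the first it is
  \<open>H + cnj s I\<close> applied to the graph of \<open>- X\<close>.  Comparing the two shows that the Cayley
  transform of \<open>H\<close> maps the graph of \<open>- X\<close> to that of \<open>- X'\<close>.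
\<close>

lemma cayley_left:
  "(H - s \<cdot>\<^sub>m 1\<^sub>m (2 * n)) * (1\<^sub>m n @\<^sub>r (- X')) = (1\<^sub>m n @\<^sub>r (- Xh)) * S"
proof -
  have "(H - s \<cdot>\<^sub>m 1\<^sub>m (2 * n)) * (1\<^sub>m n @\<^sub>r (- X'))
    = H * (1\<^sub>m n @\<^sub>r (- X')) - s \<cdot>\<^sub>m (1\<^sub>m n @\<^sub>r (- X'))"
    by (simp add: mat_expand)
  also have "\<dots> = S @\<^sub>r (Q + mat_adjoint A * X' - s \<cdot>\<^sub>m (- X'))"
    unfolding H_graph[OF next_carrier] by (simp add: append_rows_smult append_rows_minus)
  also have "Q + mat_adjoint A * X' - s \<cdot>\<^sub>m (- X') = Q + Kh * X' + Xh * (G * X')"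
    by (simp add: mat_expand) (rule eq_matI; simp add: algebra_simps del: index_mult_mat(1))
  also have "\<dots> = - (Xh * S)"
    unfolding full_step_eq
    by (simp add: mat_expand) (rule eq_matI; simp add: algebra_simps del: index_mult_mat(1))
  finally show ?thesis
    by (simp add: append_rows_mult mat_one_mult_dims mat_uminus_mult_dims)
qed

lemma cayley_right:
  "(H + cnj s \<cdot>\<^sub>m 1\<^sub>m (2 * n)) * (1\<^sub>m n @\<^sub>r (- X)) = (1\<^sub>m n @\<^sub>r (- Xh)) * mat_adjoint K"
proof -
  have "(H + cnj s \<cdot>\<^sub>m 1\<^sub>m (2 * n)) * (1\<^sub>m n @\<^sub>r (- X))
    = H * (1\<^sub>m n @\<^sub>r (- X)) + cnj s \<cdot>\<^sub>m (1\<^sub>m n @\<^sub>r (- X))"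
    by (simp add: mat_expand)
  also have "\<dots> = (A - G * X + cnj s \<cdot>\<^sub>m 1\<^sub>m n) @\<^sub>r (Q + mat_adjoint A * X + cnj s \<cdot>\<^sub>m (- X))"
    unfolding H_graph[OF X] by (simp add: append_rows_smult append_rows_add)
  also have "A - G * X + cnj s \<cdot>\<^sub>m 1\<^sub>m n = mat_adjoint K"
    unfolding adjoint_K by (rule eq_matI; simp del: index_mult_mat(1))
  also have "Q + mat_adjoint A * X + cnj s \<cdot>\<^sub>m (- X) = - (Xh * mat_adjoint K)"
    unfolding adjoint_K half_step_eq
    by (simp add: mat_expand) (rule eq_matI; simp add: algebra_simps del: index_mult_mat(1))
  finally show ?thesis
    by (simp add: append_rows_mult mat_one_mult_dims mat_uminus_mult_dims)
qed

lemma S_carrier: "S \<in> carrier_mat n n"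
  by (rule carrier_matI) simp_all

text \<open>
  If \<open>S z = 0\<close>, then the vector with the blocks \<open>z\<close> and \<open>- X' z\<close> is in the kernel of \<open>H - s I\<close>.
\<close>

lemma S_invertible:
  assumes "\<not> eigenvalue H s"
  shows "invertible_mat S"
proof (rule invertible_mat_kernel[OF S_carrier])
  note inv = shifted_invertible[OF H_carrier assms]
  fix Z assume "Z \<in> carrier_mat n 1" and SZ: "S * Z = 0\<^sub>m n 1"
  then have [simp]: "dim_row Z = n" "dim_col Z = 1" by auto
  have "(H - s \<cdot>\<^sub>m 1\<^sub>m (2 * n)) * ((1\<^sub>m n @\<^sub>r (- X')) * Z) = (1\<^sub>m n @\<^sub>r (- Xh)) * (S * Z)"
    using arg_cong[OF cayley_left, of "\<lambda>M. M * Z"] by (simp add: mat_mult_assoc_dims)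
  also have "\<dots> = (H - s \<cdot>\<^sub>m 1\<^sub>m (2 * n)) * 0\<^sub>m (2 * n) 1"
    unfolding SZ by (rule eq_matI) simp_all
  finally have "(1\<^sub>m n @\<^sub>r (- X')) * Z = 0\<^sub>m (2 * n) 1"
    by (rule mat_mult_left_cancel[OF _ inv, rotated -1]) (rule carrier_matI | simp)+
  then have 0: "Z @\<^sub>r (- X' * Z) = 0\<^sub>m (2 * n) 1"
    by (simp add: append_rows_mult mat_one_mult_dims)
  \<comment> \<open>the upper block of the graph is the identity, so it recovers the vector\<close>
  have "Z $$ (i, 0) = 0" if "i < n" for i
    using that arg_cong[OF 0, of "\<lambda>M. M $$ (i, 0)"] by (simp del: index_mult_mat(1))
  then show "Z = 0\<^sub>m n 1" by (intro eq_matI) auto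
qed

text \<open>
  Here \<open>(H - s I)\<^sup>-\<^sup>1 (H + cnj s I)\<close> applied to the graph of \<open>- X\<close> equals the graph of
  \<open>- X'\<close> times \<open>M = S\<^sup>-\<^sup>1 K\<^sup>*\<close>, so the upper block is \<open>M\<close> and the lower block \<open>- X' M\<close>.
\<close>

lemma cayley_regular:
  assumes ev: "\<not> eigenvalue H s"
  shows "cayley_formula n H s X = X'"
proof -
  note inv = shifted_invertible[OF H_carrier ev]
  have Hs: "H - s \<cdot>\<^sub>m 1\<^sub>m (2 * n) \<in> carrier_mat (2 * n) (2 * n)" by (rule carrier_matI) simp_all
  have [simp]: "dim_row (minv (H - s \<cdot>\<^sub>m 1\<^sub>m (2 * n))) = 2 * n" "dim_col (minv (H - s \<cdot>\<^sub>m 1\<^sub>m (2 * n))) = 2 * n"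
    using minv_inverse(1)[OF Hs inv] by auto
  note invS = minv_inverse[OF S_carrier S_invertible[OF ev]]
  note invK = minv_inverse[OF adj_K_carrier adj_K_invertible]
  have [simp]: "dim_row (minv S) = n" "dim_col (minv S) = n" using invS(1) by auto
  have [simp]: "dim_row (minv (mat_adjoint K)) = n" "dim_col (minv (mat_adjoint K)) = n" using invK(1) by auto
  define M where "M = minv S * mat_adjoint K"
  have [simp]: "dim_row M = n" "dim_col M = n" by (simp_all add: M_def)
  have M: "M \<in> carrier_mat n n" by (rule carrier_matI) simp_all
  have "M * (minv (mat_adjoint K) * S) = 1\<^sub>m n"
  proof -
    have "M * (minv (mat_adjoint K) * S) = minv S * (mat_adjoint K * (minv (mat_adjoint K) * S))"
      unfolding M_def by (rule mat_mult_assoc_dims) simp_all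
    also have "mat_adjoint K * (minv (mat_adjoint K) * S) = S"
      by (rule minv_mult_cancel(1)[OF adj_K_carrier adj_K_invertible]) simp
    finally show ?thesis unfolding invS(3) .
  qed
  then have M_inv: "invertible_mat M"
    by (rule invertible_mat_rightI[OF M, rotated]) (rule carrier_matI; simp)
  have "minv (H - s \<cdot>\<^sub>m 1\<^sub>m (2 * n)) * (H + cnj s \<cdot>\<^sub>m 1\<^sub>m (2 * n)) * (1\<^sub>m n @\<^sub>r (- X))
      = minv (H - s \<cdot>\<^sub>m 1\<^sub>m (2 * n)) * ((1\<^sub>m n @\<^sub>r (- Xh)) * mat_adjoint K)"
    unfolding cayley_right[symmetric] by (rule mat_mult_assoc_dims) simp_all
  also have "(1\<^sub>m n @\<^sub>r (- Xh)) * mat_adjoint K = (1\<^sub>m n @\<^sub>r (- Xh)) * (S * M)"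
    unfolding M_def by (simp only: minv_mult_cancel[OF S_carrier S_invertible[OF ev]] mat_adjoint_dims dims_K)
  also have "\<dots> = ((1\<^sub>m n @\<^sub>r (- Xh)) * S) * M"
    by (rule mat_mult_assoc_dims[symmetric]) simp_all
  also have "\<dots> = (H - s \<cdot>\<^sub>m 1\<^sub>m (2 * n)) * ((1\<^sub>m n @\<^sub>r (- X')) * M)"
    unfolding cayley_left[symmetric] by (rule mat_mult_assoc_dims) simp_all
  also have "minv (H - s \<cdot>\<^sub>m 1\<^sub>m (2 * n)) * \<dots> = (1\<^sub>m n @\<^sub>r (- X')) * M"
    by (rule minv_mult_cancel(2)[OF Hs inv]) simp
  also have "\<dots> = M @\<^sub>r (- X' * M)"
    by (simp add: append_rows_mult mat_one_mult_dims)
  finally have W: "minv (H - s \<cdot>\<^sub>m 1\<^sub>m (2 * n)) * (H + cnj s \<cdot>\<^sub>m 1\<^sub>m (2 * n)) * (1\<^sub>m n @\<^sub>r (- X))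
      = M @\<^sub>r (- X' * M)" .
  have top: "mat n n (\<lambda>(i, j). (M @\<^sub>r (- X' * M)) $$ (i, j)) = M"
    by (rule eq_matI) simp_all
  have bottom: "mat n n (\<lambda>(i, j). (M @\<^sub>r (- X' * M)) $$ (n + i, j)) = - X' * M"
    by (rule eq_matI) (simp_all del: index_mult_mat(1))
  have "- (- X' * M * minv M) = X'"
    using minv_inverse[OF M M_inv] by (simp add: mat_expand)
  then show ?thesis
    unfolding cayley_formula_def W Let_def top bottom .
qed

end

section \<open>Continuity in the shift and the Cayley step at eigenvalues\<close>

text \<open>
  Entrywise convergence.  The dimensions are required to agree only eventually, because the inverse
  of a matrix-valued function has known dimensions only where the function is invertible.
\<close>

definition mat_tendsto :: "('a \<Rightarrow> complex mat) \<Rightarrow> complex mat \<Rightarrow> 'a filter \<Rightarrow> bool" where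
  "mat_tendsto F L flt \<longleftrightarrow>
    (\<forall>\<^sub>F z in flt. dim_row (F z) = dim_row L \<and> dim_col (F z) = dim_col L) \<and>
    (\<forall>i<dim_row L. \<forall>j<dim_col L. ((\<lambda>z. F z $$ (i, j)) \<longlongrightarrow> L $$ (i, j)) flt)"

lemma tendsto_eventually_eq:
  assumes "(f \<longlongrightarrow> l) flt" "\<forall>\<^sub>F z in flt. f z = g z" "l = l'"
  shows "(g \<longlongrightarrow> l') flt"
  using Lim_transform_eventually[OF assms(1,2)] assms(3) by simp

lemma mat_tendsto_dims:
  "mat_tendsto F L flt \<Longrightarrow> \<forall>\<^sub>F z in flt. dim_row (F z) = dim_row L \<and> dim_col (F z) = dim_col L"
  by (simp add: mat_tendsto_def)

lemma mat_tendsto_index: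
  "mat_tendsto F L flt \<Longrightarrow> i < dim_row L \<Longrightarrow> j < dim_col L \<Longrightarrow>
    ((\<lambda>z. F z $$ (i, j)) \<longlongrightarrow> L $$ (i, j)) flt"
  by (simp add: mat_tendsto_def)

lemma mat_tendsto_cong:
  assumes "mat_tendsto F L flt" "\<forall>\<^sub>F z in flt. F z = F' z"
  shows "mat_tendsto F' L flt"
  unfolding mat_tendsto_def
proof (intro conjI allI impI)
  show "\<forall>\<^sub>F z in flt. dim_row (F' z) = dim_row L \<and> dim_col (F' z) = dim_col L"
    using mat_tendsto_dims[OF assms(1)] assms(2) by eventually_elim simp
  fix i j assume "i < dim_row L" "j < dim_col L"
  then show "((\<lambda>z. F' z $$ (i, j)) \<longlongrightarrow> L $$ (i, j)) flt"
    by (rule Lim_transform_eventually[OF mat_tendsto_index[OF assms(1)]])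
      (use assms(2) in eventually_elim, simp)
qed

lemma mat_tendsto_const: "mat_tendsto (\<lambda>z. L) L flt"
  by (simp add: mat_tendsto_def)

lemma mat_tendsto_add:
  assumes F: "mat_tendsto F L flt" and F': "mat_tendsto F' L' flt"
    and dims: "dim_row L = dim_row L'" "dim_col L = dim_col L'"
  shows "mat_tendsto (\<lambda>z. F z + F' z) (L + L') flt"
  unfolding mat_tendsto_def
proof (intro conjI allI impI)
  show "\<forall>\<^sub>F z in flt. dim_row (F z + F' z) = dim_row (L + L') \<and> dim_col (F z + F' z) = dim_col (L + L')"
    using mat_tendsto_dims[OF F'] by eventually_elim simp
  fix i j assume ij: "i < dim_row (L + L')" "j < dim_col (L + L')"
  then have "((\<lambda>z. F z $$ (i, j) + F' z $$ (i, j)) \<longlongrightarrow> L $$ (i, j) + L' $$ (i, j)) flt"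
    using dims by (intro tendsto_add mat_tendsto_index[OF F] mat_tendsto_index[OF F']) simp_all
  moreover have "\<forall>\<^sub>F z in flt. F z $$ (i, j) + F' z $$ (i, j) = (F z + F' z) $$ (i, j)"
    using mat_tendsto_dims[OF F'] by eventually_elim (use ij in simp)
  ultimately show "((\<lambda>z. (F z + F' z) $$ (i, j)) \<longlongrightarrow> (L + L') $$ (i, j)) flt"
    using ij by (simp add: Lim_transform_eventually)
qed

lemma mat_tendsto_smult:
  assumes f: "(f \<longlongrightarrow> l) flt" and F: "mat_tendsto F L flt"
  shows "mat_tendsto (\<lambda>z. f z \<cdot>\<^sub>m F z) (l \<cdot>\<^sub>m L) flt"
  unfolding mat_tendsto_def
proof (intro conjI allI impI)
  show "\<forall>\<^sub>F z in flt. dim_row (f z \<cdot>\<^sub>m F z) = dim_row (l \<cdot>\<^sub>m L) \<and> dim_col (f z \<cdot>\<^sub>m F z) = dim_col (l \<cdot>\<^sub>m L)"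
    using mat_tendsto_dims[OF F] by eventually_elim simp
  fix i j assume ij: "i < dim_row (l \<cdot>\<^sub>m L)" "j < dim_col (l \<cdot>\<^sub>m L)"
  then have "((\<lambda>z. f z * F z $$ (i, j)) \<longlongrightarrow> l * L $$ (i, j)) flt"
    by (intro tendsto_mult f mat_tendsto_index[OF F]) simp_all
  moreover have "\<forall>\<^sub>F z in flt. f z * F z $$ (i, j) = (f z \<cdot>\<^sub>m F z) $$ (i, j)"
    using mat_tendsto_dims[OF F] by eventually_elim (use ij in simp)
  ultimately show "((\<lambda>z. (f z \<cdot>\<^sub>m F z) $$ (i, j)) \<longlongrightarrow> (l \<cdot>\<^sub>m L) $$ (i, j)) flt"
    using ij by (simp add: Lim_transform_eventually)
qed

lemma mat_tendsto_minus:
  assumes F: "mat_tendsto F L flt" and F': "mat_tendsto F' L' flt"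
    and dims: "dim_row L = dim_row L'" "dim_col L = dim_col L'"
  shows "mat_tendsto (\<lambda>z. F z - F' z) (L - L') flt"
proof -
  have *: "M - N = M + (- 1) \<cdot>\<^sub>m N" if "dim_row M = dim_row N" "dim_col M = dim_col N" for M N :: "complex mat"
    using that by (intro eq_matI) simp_all
  have "mat_tendsto (\<lambda>z. F z + (- 1) \<cdot>\<^sub>m F' z) (L + (- 1) \<cdot>\<^sub>m L') flt"
    by (intro mat_tendsto_add mat_tendsto_smult F F' tendsto_const) (simp_all add: dims)
  then have "mat_tendsto (\<lambda>z. F z + (- 1) \<cdot>\<^sub>m F' z) (L - L') flt"
    using dims by (simp add: *)
  moreover have "\<forall>\<^sub>F z in flt. F z + (- 1) \<cdot>\<^sub>m F' z = F z - F' z"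
    using mat_tendsto_dims[OF F] mat_tendsto_dims[OF F'] by eventually_elim (simp add: * dims)
  ultimately show ?thesis by (rule mat_tendsto_cong)
qed

lemma mat_tendsto_mult:
  assumes F: "mat_tendsto F L flt" and F': "mat_tendsto F' L' flt"
    and dims: "dim_col L = dim_row L'"
  shows "mat_tendsto (\<lambda>z. F z * F' z) (L * L') flt"
  unfolding mat_tendsto_def
proof (intro conjI allI impI)
  show "\<forall>\<^sub>F z in flt. dim_row (F z * F' z) = dim_row (L * L') \<and> dim_col (F z * F' z) = dim_col (L * L')"
    using mat_tendsto_dims[OF F] mat_tendsto_dims[OF F'] by eventually_elim simp
  fix i j assume ij: "i < dim_row (L * L')" "j < dim_col (L * L')"
  then have "((\<lambda>z. \<Sum>l<dim_row L'. F z $$ (i, l) * F' z $$ (l, j))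
      \<longlongrightarrow> (\<Sum>l<dim_row L'. L $$ (i, l) * L' $$ (l, j))) flt"
    using dims by (intro tendsto_sum tendsto_mult mat_tendsto_index[OF F] mat_tendsto_index[OF F']) simp_all
  moreover have "\<forall>\<^sub>F z in flt. (\<Sum>l<dim_row L'. F z $$ (i, l) * F' z $$ (l, j)) = (F z * F' z) $$ (i, j)"
    using mat_tendsto_dims[OF F] mat_tendsto_dims[OF F']
    by eventually_elim (use ij dims in \<open>simp add: scalar_prod_def atLeast0LessThan\<close>)
  moreover have "(\<Sum>l<dim_row L'. L $$ (i, l) * L' $$ (l, j)) = (L * L') $$ (i, j)"
    using ij dims by (simp add: scalar_prod_def atLeast0LessThan)
  ultimately show "((\<lambda>z. (F z * F' z) $$ (i, j)) \<longlongrightarrow> (L * L') $$ (i, j)) flt"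
    by (rule tendsto_eventually_eq)
qed

lemma mat_tendsto_adjoint:
  assumes F: "mat_tendsto F L flt"
  shows "mat_tendsto (\<lambda>z. mat_adjoint (F z)) (mat_adjoint L) flt"
  unfolding mat_tendsto_def
proof (intro conjI allI impI)
  show "\<forall>\<^sub>F z in flt. dim_row (mat_adjoint (F z)) = dim_row (mat_adjoint L) \<and>
      dim_col (mat_adjoint (F z)) = dim_col (mat_adjoint L)"
    using mat_tendsto_dims[OF F] by eventually_elim simp
  fix i j assume ij: "i < dim_row (mat_adjoint L)" "j < dim_col (mat_adjoint L)"
  then have "((\<lambda>z. cnj (F z $$ (j, i))) \<longlongrightarrow> cnj (L $$ (j, i))) flt"
    by (intro tendsto_cnj mat_tendsto_index[OF F]) simp_all
  moreover have "\<forall>\<^sub>F z in flt. cnj (F z $$ (j, i)) = mat_adjoint (F z) $$ (i, j)"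
    using mat_tendsto_dims[OF F] by eventually_elim (use ij in simp)
  ultimately show "((\<lambda>z. mat_adjoint (F z) $$ (i, j)) \<longlongrightarrow> mat_adjoint L $$ (i, j)) flt"
    using ij by (simp add: Lim_transform_eventually)
qed

lemma mat_tendsto_det:
  assumes F: "mat_tendsto F L flt" and L: "L \<in> carrier_mat n n"
  shows "((\<lambda>z. det (F z)) \<longlongrightarrow> det L) flt"
proof -
  have "((\<lambda>z. \<Sum>p\<in>{p. p permutes {0..<n}}. signof p * (\<Prod>i = 0..<n. F z $$ (i, p i)))
    \<longlongrightarrow> (\<Sum>p\<in>{p. p permutes {0..<n}}. signof p * (\<Prod>i = 0..<n. L $$ (i, p i)))) flt"
  proof (intro tendsto_sum tendsto_mult tendsto_const tendsto_prod)
    fix p i assume "p \<in> {p. p permutes {0..<n}}" "i \<in> {0..<n}"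
    then have "i < n" "p i < n" using permutes_in_image[of p "{0..<n}" i] by auto
    then show "((\<lambda>z. F z $$ (i, p i)) \<longlongrightarrow> L $$ (i, p i)) flt"
      using L by (intro mat_tendsto_index[OF F]) auto
  qed
  then have "((\<lambda>z. \<Sum>p\<in>{p. p permutes {0..<n}}. signof p * (\<Prod>i = 0..<n. F z $$ (i, p i)))
    \<longlongrightarrow> det L) flt"
    unfolding det_def'[OF L] .
  then show ?thesis
  proof (rule Lim_transform_eventually)
    show "\<forall>\<^sub>F z in flt. (\<Sum>p\<in>{p. p permutes {0..<n}}. signof p * (\<Prod>i = 0..<n. F z $$ (i, p i))) = det (F z)"
      using mat_tendsto_dims[OF F] by eventually_elim (use L in \<open>simp add: det_def\<close>)
  qed
qed

lemma mat_tendsto_delete: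
  assumes F: "mat_tendsto F L flt"
  shows "mat_tendsto (\<lambda>z. mat_delete (F z) k l) (mat_delete L k l) flt"
  unfolding mat_tendsto_def
proof (intro conjI allI impI)
  show "\<forall>\<^sub>F z in flt. dim_row (mat_delete (F z) k l) = dim_row (mat_delete L k l) \<and>
      dim_col (mat_delete (F z) k l) = dim_col (mat_delete L k l)"
    using mat_tendsto_dims[OF F] by eventually_elim (simp add: mat_delete_def)
  fix i j assume ij: "i < dim_row (mat_delete L k l)" "j < dim_col (mat_delete L k l)"
  define i' j' where "i' = (if i < k then i else Suc i)" and "j' = (if j < l then j else Suc j)"
  have "((\<lambda>z. F z $$ (i', j')) \<longlongrightarrow> L $$ (i', j')) flt"
    using ij by (intro mat_tendsto_index[OF F]) (auto simp: mat_delete_def i'_def j'_def)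
  moreover have "\<forall>\<^sub>F z in flt. F z $$ (i', j') = mat_delete (F z) k l $$ (i, j)"
    using mat_tendsto_dims[OF F]
    by eventually_elim (use ij in \<open>simp add: mat_delete_def i'_def j'_def\<close>)
  moreover have "L $$ (i', j') = mat_delete L k l $$ (i, j)"
    using ij by (simp add: mat_delete_def i'_def j'_def)
  ultimately show "((\<lambda>z. mat_delete (F z) k l $$ (i, j)) \<longlongrightarrow> mat_delete L k l $$ (i, j)) flt"
    by (rule tendsto_eventually_eq)
qed

lemma minv_eq_adj_mat:
  assumes A: "A \<in> carrier_mat n n" and inv: "invertible_mat A"
  shows "minv A = (1 / det A) \<cdot>\<^sub>m adj_mat A"
proof (rule minv_unique[OF A])
  have "det A \<noteq> 0" using inv invertible_mat_iff_det[OF A] by simp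
  then show "A * ((1 / det A) \<cdot>\<^sub>m adj_mat A) = 1\<^sub>m n"
    using adj_mat[OF A] A by (auto simp: mat_mult_smult_dims intro!: eq_matI)
  show "(1 / det A) \<cdot>\<^sub>m adj_mat A \<in> carrier_mat n n" using adj_mat(1)[OF A] by simp
qed

lemma eventually_invertible_mat:
  assumes F: "mat_tendsto F L flt" and L: "L \<in> carrier_mat n n" "invertible_mat L"
  shows "\<forall>\<^sub>F z in flt. F z \<in> carrier_mat n n \<and> invertible_mat (F z)"
proof -
  have "\<forall>\<^sub>F z in flt. det (F z) \<noteq> 0"
    using tendsto_imp_eventually_ne[OF mat_tendsto_det[OF F L(1)]] L invertible_mat_iff_det by blast
  moreover have "\<forall>\<^sub>F z in flt. F z \<in> carrier_mat n n"
    using mat_tendsto_dims[OF F] by eventually_elim (use L in auto)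
  ultimately show ?thesis by eventually_elim (simp add: invertible_mat_iff_det)
qed

text \<open>
  Near a nonsingular limit the inverse is the adjugate divided by the determinant, and both are
  polynomials in the entries.
\<close>

lemma mat_tendsto_minv:
  assumes F: "mat_tendsto F L flt" and L: "L \<in> carrier_mat n n" "invertible_mat L"
  shows "mat_tendsto (\<lambda>z. minv (F z)) (minv L) flt"
proof -
  have "det L \<noteq> 0" using L invertible_mat_iff_det by blast
  have "mat_tendsto (\<lambda>z. adj_mat (F z)) (adj_mat L) flt"
    unfolding mat_tendsto_def
  proof (intro conjI allI impI)
    show "\<forall>\<^sub>F z in flt. dim_row (adj_mat (F z)) = dim_row (adj_mat L) \<and>
        dim_col (adj_mat (F z)) = dim_col (adj_mat L)"
      using mat_tendsto_dims[OF F] by eventually_elim (simp add: adj_mat_def)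
    fix i j assume ij: "i < dim_row (adj_mat L)" "j < dim_col (adj_mat L)"
    have "mat_delete L j i \<in> carrier_mat (n - 1) (n - 1)"
      using L(1) by (intro carrier_matI) (auto simp: mat_delete_def)
    then have "((\<lambda>z. cofactor (F z) j i) \<longlongrightarrow> cofactor L j i) flt"
      unfolding cofactor_def
      by (intro tendsto_mult tendsto_const mat_tendsto_det[OF mat_tendsto_delete[OF F]])
    moreover have "\<forall>\<^sub>F z in flt. cofactor (F z) j i = adj_mat (F z) $$ (i, j)"
      using mat_tendsto_dims[OF F] by eventually_elim (use ij in \<open>simp add: adj_mat_def\<close>)
    moreover have "cofactor L j i = adj_mat L $$ (i, j)"
      using ij by (simp add: adj_mat_def)
    ultimately show "((\<lambda>z. adj_mat (F z) $$ (i, j)) \<longlongrightarrow> adj_mat L $$ (i, j)) flt"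
      by (rule tendsto_eventually_eq)
  qed
  then have "mat_tendsto (\<lambda>z. (1 / det (F z)) \<cdot>\<^sub>m adj_mat (F z)) (minv L) flt"
    unfolding minv_eq_adj_mat[OF L]
    by (intro mat_tendsto_smult tendsto_divide tendsto_const mat_tendsto_det[OF F L(1)] \<open>det L \<noteq> 0\<close>)
  then show ?thesis
  proof (rule mat_tendsto_cong)
    show "\<forall>\<^sub>F z in flt. (1 / det (F z)) \<cdot>\<^sub>m adj_mat (F z) = minv (F z)"
      using eventually_invertible_mat[OF F L]
      by eventually_elim (erule conjE, rule minv_eq_adj_mat[symmetric])
  qed
qed

context radi_step begin

lemma radi_coeff_tendsto: "mat_tendsto (\<lambda>z. radi_coeff A B z X) K (at s)"
  unfolding radi_coeff_def
  by (intro mat_tendsto_add mat_tendsto_smult mat_tendsto_const tendsto_ident_at) simp_all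

lemma next_tendsto: "mat_tendsto (\<lambda>z. radi_next p A B z X R) X' (at s)"
proof -
  have Re: "((\<lambda>z. Re z) \<longlongrightarrow> Re s) (at s)" by (intro tendsto_Re tendsto_ident_at)
  have V: "mat_tendsto (\<lambda>z. radi_V A B z X R) V (at s)"
    unfolding radi_V_def
    by (intro mat_tendsto_smult mat_tendsto_mult mat_tendsto_minv[OF radi_coeff_tendsto K_carrier regular]
        mat_tendsto_const tendsto_of_real tendsto_real_sqrt tendsto_mult Re tendsto_const) simp
  have W: "mat_tendsto (\<lambda>z. mat_adjoint (radi_V A B z X R) * B) (mat_adjoint V * B) (at s)"
    by (intro mat_tendsto_mult mat_tendsto_adjoint V mat_tendsto_const) simp
  have Y: "mat_tendsto (\<lambda>z. radi_Yt p B z (radi_V A B z X R)) Y (at s)"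
    unfolding radi_Yt_def
    by (intro mat_tendsto_minus mat_tendsto_smult mat_tendsto_mult W mat_tendsto_adjoint
        mat_tendsto_const tendsto_of_real tendsto_divide tendsto_mult Re tendsto_const)
      (use stable in simp_all)
  show ?thesis
    unfolding radi_next_def Let_def
    by (intro mat_tendsto_add mat_tendsto_mult mat_tendsto_adjoint V mat_tendsto_const
        mat_tendsto_minv[OF Y Y_carrier Y_invertible]) simp_all
qed

text \<open>
  The iterate \<open>X'\<close> is defined and continuous in the shift as long as \<open>K\<close> stays nonsingular,
  whether or not the shift is an eigenvalue of \<open>H\<close>.  Since \<open>H\<close> has finitely many eigenvalues, the
  Cayley formula agrees with it at all nearby shifts different from \<open>s\<close>, and so its limit is \<open>X'\<close>.
\<close>

lemma cayley_step: "cayley_step n H s X = X'"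
proof (cases "eigenvalue H s")
  case False
  then show ?thesis by (simp add: cayley_step_def cayley_regular)
next
  case True
  have "open (- (spectrum H - {s}))"
    using card_finite_spectrum(1)[OF H_carrier] by (intro open_Compl finite_imp_closed) simp
  then have "\<forall>\<^sub>F z in at s. \<not> eigenvalue H z"
    unfolding eventually_at_topological
    by (intro exI[of _ "- (spectrum H - {s})"]) (auto simp: spectrum_def)
  moreover have "((\<lambda>z. Re z) \<longlongrightarrow> Re s) (at s)" by (intro tendsto_Re tendsto_ident_at)
  then have "\<forall>\<^sub>F z in at s. Re z < 0" using stable by (rule order_tendstoD)
  moreover have "\<forall>\<^sub>F z in at s. invertible_mat (radi_coeff A B z X)"
    using eventually_invertible_mat[OF radi_coeff_tendsto K_carrier regular] by eventually_elim simp
  ultimately have "\<forall>\<^sub>F z in at s. radi_next p A B z X R = cayley_formula n H z X"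
  proof eventually_elim
    case (elim z)
    interpret z: radi_step n m p A B Q X R z
      using A B Q X R herm residual elim by unfold_locales
    show ?case using z.cayley_regular elim by simp
  qed
  then have lim: "mat_tendsto (\<lambda>z. cayley_formula n H z X) X' (at s)"
    by (rule mat_tendsto_cong[OF next_tendsto])
  have "mat n n (\<lambda>ij. Lim (at s) (\<lambda>z. cayley_formula n H z X $$ ij)) = X'"
  proof (rule eq_matI)
    fix i j assume ij: "i < dim_row X'" "j < dim_col X'"
    then have "Lim (at s) (\<lambda>z. cayley_formula n H z X $$ (i, j)) = X' $$ (i, j)"
      by (intro tendsto_Lim mat_tendsto_index[OF lim]) simp_all
    then show "mat n n (\<lambda>ij. Lim (at s) (\<lambda>z. cayley_formula n H z X $$ ij)) $$ (i, j) = X' $$ (i, j)"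
      using ij by simp
  qed simp_all
  then show ?thesis using True by (simp add: cayley_step_def)
qed

end

section \<open>The RADI iteration as a sequence of steps\<close>

lemma append_cols_mult_append_rows:
  assumes Z: "Z \<in> carrier_mat n q" and V: "V \<in> carrier_mat n p"
    and P: "P \<in> carrier_mat q k" and S: "S \<in> carrier_mat p k"
  shows "append_cols Z V * (P @\<^sub>r S) = Z * P + V * (S :: complex mat)"
proof -
  have "append_cols Z V * (P @\<^sub>r S)
      = four_block_mat Z V (0\<^sub>m 0 q) (0\<^sub>m 0 p) * four_block_mat P (0\<^sub>m q 0) S (0\<^sub>m p 0)"
    using Z V P S by (simp add: append_cols_def append_rows_def)
  also have "\<dots> = four_block_mat (Z * P + V * S) (Z * 0\<^sub>m q 0 + V * 0\<^sub>m p 0)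
      (0\<^sub>m 0 q * P + 0\<^sub>m 0 p * S) (0\<^sub>m 0 q * 0\<^sub>m q 0 + 0\<^sub>m 0 p * 0\<^sub>m p 0)"
    by (rule mult_four_block_mat[OF Z V zero_carrier_mat zero_carrier_mat P zero_carrier_mat S zero_carrier_mat])
  also have "\<dots> = Z * P + V * S"
    using Z V P S by (intro eq_matI) (simp_all del: index_mult_mat(1))
  finally show ?thesis .
qed

lemma mat_adjoint_append_cols:
  assumes "dim_row Z = dim_row V"
  shows "mat_adjoint (append_cols Z V) = mat_adjoint Z @\<^sub>r mat_adjoint (V :: complex mat)"
  by (rule eq_matI) (use assms in \<open>auto simp: append_cols_def\<close>)

abbreviation block_diag :: "complex mat \<Rightarrow> complex mat \<Rightarrow> complex mat" where
  "block_diag Y Y' \<equiv> four_block_mat Y (0\<^sub>m (dim_row Y) (dim_col Y')) (0\<^sub>m (dim_row Y') (dim_col Y)) Y'"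

lemma block_diag_minv:
  assumes Y: "Y \<in> carrier_mat q q" "invertible_mat Y" and Y': "Y' \<in> carrier_mat p p" "invertible_mat Y'"
  shows "invertible_mat (block_diag Y Y')" "minv (block_diag Y Y') = block_diag (minv Y) (minv Y')"
proof -
  note inv = minv_inverse[OF Y] minv_inverse[OF Y']
  have [simp]: "dim_row Y = q" "dim_col Y = q" "dim_row Y' = p" "dim_col Y' = p"
    "dim_row (minv Y) = q" "dim_col (minv Y) = q" "dim_row (minv Y') = p" "dim_col (minv Y') = p"
    using Y Y' inv by auto
  have "block_diag Y Y' * block_diag (minv Y) (minv Y')
    = four_block_mat (Y * minv Y + 0\<^sub>m q p * 0\<^sub>m p q) (Y * 0\<^sub>m q p + 0\<^sub>m q p * minv Y')
        (0\<^sub>m p q * minv Y + Y' * 0\<^sub>m p q) (0\<^sub>m p q * 0\<^sub>m q p + Y' * minv Y')"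
    unfolding \<open>dim_row Y = q\<close> \<open>dim_col Y = q\<close> \<open>dim_row Y' = p\<close> \<open>dim_col Y' = p\<close>
      \<open>dim_row (minv Y) = q\<close> \<open>dim_col (minv Y) = q\<close> \<open>dim_row (minv Y') = p\<close> \<open>dim_col (minv Y') = p\<close>
    by (rule mult_four_block_mat[OF Y(1) zero_carrier_mat zero_carrier_mat Y'(1) inv(1) zero_carrier_mat zero_carrier_mat inv(4)])
  also have "\<dots> = four_block_mat (1\<^sub>m q) (0\<^sub>m q p) (0\<^sub>m p q) (1\<^sub>m p)"
    unfolding inv(2,5) by (rule cong_four_block_mat) (rule eq_matI; simp)+
  also have "\<dots> = 1\<^sub>m (q + p)" by (rule four_block_one_mat)
  finally have eq: "block_diag Y Y' * block_diag (minv Y) (minv Y') = 1\<^sub>m (q + p)" .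
  have c: "block_diag Y Y' \<in> carrier_mat (q + p) (q + p)"
    "block_diag (minv Y) (minv Y') \<in> carrier_mat (q + p) (q + p)"
    by (rule carrier_matI; simp)+
  show "invertible_mat (block_diag Y Y')" by (rule invertible_mat_rightI[OF c eq])
  show "minv (block_diag Y Y') = block_diag (minv Y) (minv Y')" by (rule minv_unique[OF c eq])
qed

lemma block_diag_mult_append_rows:
  assumes Y: "Y \<in> carrier_mat q q" and Y': "Y' \<in> carrier_mat p p"
    and P: "P \<in> carrier_mat q k" and S: "S \<in> carrier_mat p k"
  shows "block_diag Y Y' * (P @\<^sub>r S) = (Y * P) @\<^sub>r (Y' * S)"
proof -
  have "block_diag Y Y' * (P @\<^sub>r S)
      = four_block_mat Y (0\<^sub>m q p) (0\<^sub>m p q) Y' * four_block_mat P (0\<^sub>m q 0) S (0\<^sub>m p 0)"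
    using Y Y' P S by (simp add: append_rows_def)
  also have "\<dots> = four_block_mat (Y * P + 0\<^sub>m q p * S) (Y * 0\<^sub>m q 0 + 0\<^sub>m q p * 0\<^sub>m p 0)
      (0\<^sub>m p q * P + Y' * S) (0\<^sub>m p q * 0\<^sub>m q 0 + Y' * 0\<^sub>m p 0)"
    by (rule mult_four_block_mat[OF Y zero_carrier_mat zero_carrier_mat Y' P zero_carrier_mat S zero_carrier_mat])
  also have "\<dots> = (Y * P) @\<^sub>r (Y' * S)"
    unfolding append_rows_def using Y Y' P S
    by (intro cong_four_block_mat) (simp_all add: carrier_matD)
  finally show ?thesis .
qed

text \<open>
  Since the middle matrix is block diagonal, appending a block column to \<open>Z\<close> adds one summand to
  \<open>Z Y\<^sup>-\<^sup>1 Z\<^sup>*\<close>.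
\<close>

lemma radi_X_append:
  assumes Z: "Z \<in> carrier_mat n q" and V: "V \<in> carrier_mat n p"
    and Y: "Y \<in> carrier_mat q q" "invertible_mat Y" and Y': "Y' \<in> carrier_mat p p" "invertible_mat Y'"
  shows "radi_X (append_cols Z V) (block_diag Y Y') = radi_X Z Y + V * minv Y' * mat_adjoint V"
proof -
  note inv = minv_inverse[OF Y] minv_inverse[OF Y']
  have [simp]: "dim_row Z = n" "dim_col Z = q" "dim_row V = n" "dim_col V = p"
    "dim_row (minv Y) = q" "dim_col (minv Y) = q" "dim_row (minv Y') = p" "dim_col (minv Y') = p"
    using Z V inv by auto
  have "radi_X (append_cols Z V) (block_diag Y Y')
      = append_cols Z V * (block_diag (minv Y) (minv Y') * (mat_adjoint Z @\<^sub>r mat_adjoint V))"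
    unfolding radi_X_def block_diag_minv(2)[OF Y Y'] mat_adjoint_append_cols[of Z V, simplified]
    by (rule mat_mult_assoc_dims) (simp_all add: append_cols_def)
  also have "block_diag (minv Y) (minv Y') * (mat_adjoint Z @\<^sub>r mat_adjoint V)
      = (minv Y * mat_adjoint Z) @\<^sub>r (minv Y' * mat_adjoint V)"
    by (rule block_diag_mult_append_rows[OF inv(1,4), of _ n]) (rule carrier_matI; simp)+
  also have "append_cols Z V * \<dots> = Z * (minv Y * mat_adjoint Z) + V * (minv Y' * mat_adjoint V)"
    by (rule append_cols_mult_append_rows[OF Z V, of _ n]) (rule carrier_matI; simp)+
  finally show ?thesis
    unfolding radi_X_def by (simp add: mat_mult_assoc_dims)
qed

definition radi_R :: "complex mat \<Rightarrow> complex mat \<Rightarrow> complex mat \<Rightarrow> (nat \<Rightarrow> complex) \<Rightarrow> nat \<Rightarrow> complex mat" where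
  "radi_R A B C \<sigma> k = snd (snd (radi_state A B C \<sigma> k))"

lemma radi_state_Suc:
  assumes st: "radi_state A B C \<sigma> k = (Z, Y, R)" and C: "dim_row C = p"
  defines "V \<equiv> radi_V A B (\<sigma> (Suc k)) (radi_X Z Y) R"
  shows "radi_state A B C \<sigma> (Suc k) =
    (append_cols Z V, block_diag Y (radi_Yt p B (\<sigma> (Suc k)) V),
     R + complex_of_real (sqrt (- 2 * Re (\<sigma> (Suc k)))) \<cdot>\<^sub>m (V * minv (radi_Yt p B (\<sigma> (Suc k)) V)))"
  unfolding radi_state.simps st Let_def prod.case V_def radi_V_def radi_Yt_def C by simp

lemma empty_minv:
  "invertible_mat (0\<^sub>m 0 0 :: complex mat)" "minv (0\<^sub>m 0 0) \<in> carrier_mat 0 0"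
proof -
  have one: "0\<^sub>m 0 0 = (1\<^sub>m 0 :: complex mat)" by (rule eq_matI) simp_all
  show inv: "invertible_mat (0\<^sub>m 0 0 :: complex mat)"
    unfolding one by (rule invertible_mat_rightI[of _ 0 "1\<^sub>m 0"]) simp_all
  show "minv (0\<^sub>m 0 0) \<in> carrier_mat 0 0" by (rule minv_inverse(1)[OF zero_carrier_mat inv])
qed

lemma radi_X_empty: "radi_X (0\<^sub>m n 0) (0\<^sub>m 0 0) = 0\<^sub>m n n"
  unfolding radi_X_def using empty_minv(2) by (intro eq_matI) (simp_all add: scalar_prod_def)

text \<open>
  The invariant of the iteration is that the current approximation is Hermitian with residual
  \<open>R R\<^sup>*\<close>.  It holds initially with \<open>R = C\<^sup>*\<close> and makes every step an
  instance of \<^locale>\<open>radi_step\<close>.  The remaining parts restate the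
  recursion for the state as one for the approximations and the residual factors alone.
\<close>

lemma radi_run:
  assumes A: "A \<in> carrier_mat n n" and B: "B \<in> carrier_mat n m" and C: "C \<in> carrier_mat p n"
    and shifts: "\<And>j. j \<ge> 1 \<Longrightarrow> Re (\<sigma> j) < 0"
    and defined: "radi_defined A B C \<sigma> k"
  shows "\<exists>Z Y R q. radi_state A B C \<sigma> k = (Z, Y, R) \<and> Z \<in> carrier_mat n q \<and>
      Y \<in> carrier_mat q q \<and> invertible_mat Y \<and> R \<in> carrier_mat n p \<and>
      radi_X Z Y \<in> carrier_mat n n \<and> mat_adjoint (radi_X Z Y) = radi_X Z Y \<and>
      mat_adjoint A * radi_X Z Y + radi_X Z Y * A + mat_adjoint C * C
        - radi_X Z Y * (B * mat_adjoint B) * radi_X Z Y = R * mat_adjoint R" (is "?Inv k")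
    and "j < k \<Longrightarrow> radi_step n m p A B (mat_adjoint C * C) (radi_approx A B C \<sigma> j) (radi_R A B C \<sigma> j) (\<sigma> (Suc j))"
    and "j < k \<Longrightarrow> radi_approx A B C \<sigma> (Suc j) =
      radi_next p A B (\<sigma> (Suc j)) (radi_approx A B C \<sigma> j) (radi_R A B C \<sigma> j)"
    and "j < k \<Longrightarrow> radi_R A B C \<sigma> (Suc j) = radi_R A B C \<sigma> j +
      complex_of_real (sqrt (- 2 * Re (\<sigma> (Suc j)))) \<cdot>\<^sub>m
        (let V = radi_V A B (\<sigma> (Suc j)) (radi_approx A B C \<sigma> j) (radi_R A B C \<sigma> j)
         in V * minv (radi_Yt p B (\<sigma> (Suc j)) V))"
proof -
  have [simp]: "dim_row A = n" "dim_col A = n" "dim_row B = n" "dim_col B = m" "dim_row C = p" "dim_col C = n"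
    using A B C by auto
  have Q: "mat_adjoint C * C \<in> carrier_mat n n" by (rule carrier_matI) simp_all
  let ?step = "\<lambda>i. radi_step n m p A B (mat_adjoint C * C) (radi_approx A B C \<sigma> i) (radi_R A B C \<sigma> i) (\<sigma> (Suc i))"
  have step: "?step i" if "?Inv i" "i < k" for i
  proof -
    from that(1) obtain Z Y R q where st: "radi_state A B C \<sigma> i = (Z, Y, R)"
      and X: "R \<in> carrier_mat n p" "radi_X Z Y \<in> carrier_mat n n" "mat_adjoint (radi_X Z Y) = radi_X Z Y"
        "mat_adjoint A * radi_X Z Y + radi_X Z Y * A + mat_adjoint C * C
        - radi_X Z Y * (B * mat_adjoint B) * radi_X Z Y = R * mat_adjoint R" by blast
    have *: "radi_approx A B C \<sigma> i = radi_X Z Y" "radi_R A B C \<sigma> i = R"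
      by (simp_all add: radi_approx_def radi_R_def st)
    have "invertible_mat (radi_coeff A B (\<sigma> (Suc i)) (radi_approx A B C \<sigma> i))"
      using defined that(2) unfolding radi_defined_def by (auto dest!: bspec[of _ _ "Suc i"])
    then show ?thesis
      unfolding * using X A B Q shifts[of "Suc i"] by unfold_locales simp_all
  qed
  have inv: "?Inv i" if "i \<le> k" for i
    using that
  proof (induction i)
    case 0
    have "mat_adjoint A * 0\<^sub>m n n + 0\<^sub>m n n * A + mat_adjoint C * C - 0\<^sub>m n n * (B * mat_adjoint B) * 0\<^sub>m n n
        = mat_adjoint C * C"
    proof -
      have G: "B * mat_adjoint B \<in> carrier_mat n n" by (rule carrier_matI) simp_all
      have "mat_adjoint A * 0\<^sub>m n n = 0\<^sub>m n n" "0\<^sub>m n n * A = 0\<^sub>m n n"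
        "0\<^sub>m n n * (B * mat_adjoint B) = 0\<^sub>m n n"
        using A left_mult_zero_mat[OF G] by simp_all
      then show ?thesis using Q by (simp, intro eq_matI) (simp_all del: index_mult_mat(1))
    qed
    then show ?case
      by (intro exI[of _ "0\<^sub>m n 0"] exI[of _ "0\<^sub>m 0 0"] exI[of _ "mat_adjoint C"] exI[of _ "0::nat"])
        (simp add: radi_X_empty empty_minv(1) mat_adjoint_zero C)
  next
    case (Suc i)
    then have IH: "?Inv i" and i: "i < k" by auto
    from IH obtain Z Y R q where st: "radi_state A B C \<sigma> i = (Z, Y, R)"
      and Z: "Z \<in> carrier_mat n q" and Y: "Y \<in> carrier_mat q q" "invertible_mat Y" by blast
    have *: "radi_approx A B C \<sigma> i = radi_X Z Y" "radi_R A B C \<sigma> i = R"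
      by (simp_all add: radi_approx_def radi_R_def st)
    interpret radi_step n m p A B "mat_adjoint C * C" "radi_X Z Y" R "\<sigma> (Suc i)"
      using step[OF IH i] unfolding * .
    have X: "radi_X (append_cols Z V) (block_diag Y local.Y) = X'"
      unfolding radi_X_append[OF Z V_carrier Y Y_carrier Y_invertible] radi_next_def Let_def ..
    have c1: "append_cols Z V \<in> carrier_mat n (q + p)"
      using Z by (intro carrier_matI) (simp_all add: append_cols_def)
    have c2: "block_diag Y local.Y \<in> carrier_mat (q + p) (q + p)"
      using Y by (intro carrier_matI) simp_all
    have c3: "R' \<in> carrier_mat n p" by (rule carrier_matI) simp_all
    show ?case
      unfolding radi_state_Suc[OF st \<open>dim_row C = p\<close>] c_def[symmetric]
      using c1 c2 c3 X next_carrier next_herm next_residual block_diag_minv(1)[OF Y Y_carrier Y_invertible]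
      by (intro exI[of _ "append_cols Z V"] exI[of _ "block_diag Y local.Y"] exI[of _ R'] exI[of _ "q + p"]) simp
  qed
  show "?Inv k" by (rule inv) simp
  assume j: "j < k"
  then have Inv: "?Inv j" by (intro inv) simp
  show "?step j" by (rule step[OF Inv j])
  from Inv obtain Z Y R q where st: "radi_state A B C \<sigma> j = (Z, Y, R)"
    and Z: "Z \<in> carrier_mat n q" and Y: "Y \<in> carrier_mat q q" "invertible_mat Y" by blast
  have *: "radi_approx A B C \<sigma> j = radi_X Z Y" "radi_R A B C \<sigma> j = R"
    by (simp_all add: radi_approx_def radi_R_def st)
  interpret radi_step n m p A B "mat_adjoint C * C" "radi_X Z Y" R "\<sigma> (Suc j)"
    using step[OF Inv j] unfolding * .
  have X: "radi_X (append_cols Z V) (block_diag Y local.Y) = X'"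
    unfolding radi_X_append[OF Z V_carrier Y Y_carrier Y_invertible] radi_next_def Let_def ..
  show "radi_approx A B C \<sigma> (Suc j) =
      radi_next p A B (\<sigma> (Suc j)) (radi_approx A B C \<sigma> j) (radi_R A B C \<sigma> j)"
    unfolding * unfolding radi_approx_def radi_state_Suc[OF st \<open>dim_row C = p\<close>]
    by (simp only: Let_def prod.case X)
  show "radi_R A B C \<sigma> (Suc j) = radi_R A B C \<sigma> j +
      complex_of_real (sqrt (- 2 * Re (\<sigma> (Suc j)))) \<cdot>\<^sub>m
        (let V = radi_V A B (\<sigma> (Suc j)) (radi_approx A B C \<sigma> j) (radi_R A B C \<sigma> j)
         in V * minv (radi_Yt p B (\<sigma> (Suc j)) V))"
    unfolding * Let_def unfolding radi_R_def radi_state_Suc[OF st \<open>dim_row C = p\<close>] by simp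
qed

section \<open>Invariant subspaces and rank-one outputs\<close>

text \<open>
  After triangularization of \<open>\<Lambda>\<close> the progress of the iteration towards the invariant subspace is
  measured by the number of leading columns of \<open>X P + N\<close> that vanish.  An upper triangular factor on
  the right acts on the first nonvanishing column as multiplication by its diagonal entry, which
  is what the next lemmas exploit.
\<close>

definition zero_cols :: "nat \<Rightarrow> complex mat \<Rightarrow> bool" where
  "zero_cols j M \<longleftrightarrow> (\<forall>r<dim_row M. \<forall>i<j. i < dim_col M \<longrightarrow> M $$ (r, i) = 0)"

lemma zero_cols_mult_left:
  assumes "zero_cols j M" "dim_col E = dim_row M"
  shows "zero_cols j (E * M)"
  using assms unfolding zero_cols_def by (auto simp: scalar_prod_def)

lemma mult_upper_triangular_index:
  assumes M: "zero_cols i M" and T: "T \<in> carrier_mat k k" "upper_triangular T"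
    and dims: "dim_col M = k" "r < dim_row M" "i < k"
  shows "(M * T) $$ (r, i) = M $$ (r, i) * T $$ (i, i)"
proof -
  have "(M * T) $$ (r, i) = (\<Sum>l\<in>{0..<k}. M $$ (r, l) * T $$ (l, i))"
    using T dims by (simp add: scalar_prod_def)
  also have "\<dots> = (\<Sum>l\<in>{i}. M $$ (r, l) * T $$ (l, i))"
  proof (rule sum.mono_neutral_right)
    show "\<forall>l\<in>{0..<k} - {i}. M $$ (r, l) * T $$ (l, i) = 0"
    proof
      fix l assume l: "l \<in> {0..<k} - {i}"
      show "M $$ (r, l) * T $$ (l, i) = 0"
      proof (cases "l < i")
        case True
        then show ?thesis using M dims l by (simp add: zero_cols_def)
      next
        case False
        then have "T $$ (l, i) = 0" using T l by (intro upper_triangularD) auto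
        then show ?thesis by simp
      qed
    qed
  qed (use dims in auto)
  finally show ?thesis by simp
qed

lemma zero_cols_mono: "zero_cols j M \<Longrightarrow> i \<le> j \<Longrightarrow> zero_cols i M"
  by (auto simp: zero_cols_def)

lemma zero_cols_cancel_triangular:
  assumes "zero_cols j (M * T)" and T: "T \<in> carrier_mat k k" "upper_triangular T"
    and diag: "\<And>i. i < k \<Longrightarrow> T $$ (i, i) \<noteq> 0" and dims: "dim_col M = k"
  shows "zero_cols j M"
  using assms(1)
proof (induction j)
  case 0
  then show ?case by (simp add: zero_cols_def)
next
  case (Suc j)
  then have IH: "zero_cols j M" using zero_cols_mono[of "Suc j" "M * T" j] by simp
  have "M $$ (r, j) = 0" if "r < dim_row M" "j < k" for r
  proof -
    have "(M * T) $$ (r, j) = 0"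
      using Suc.prems that T unfolding zero_cols_def by simp
    then show ?thesis
      using mult_upper_triangular_index[OF IH T dims that] diag[OF that(2)] by simp
  qed
  then show ?case
    using IH dims by (auto simp: zero_cols_def less_Suc_eq)
qed

lemma zero_cols_mult_triangular_Suc:
  assumes M: "zero_cols j M" and T: "T \<in> carrier_mat k k" "upper_triangular T"
    and diag: "T $$ (j, j) = 0" and dims: "dim_col M = k"
  shows "zero_cols (Suc j) (M * T)"
  unfolding zero_cols_def
proof (intro allI impI)
  fix r i assume *: "r < dim_row (M * T)" "i < Suc j" "i < dim_col (M * T)"
  then have r: "r < dim_row M" "i < k" using T by auto
  have "zero_cols i M" using M * by (auto intro: zero_cols_mono)
  then have "(M * T) $$ (r, i) = M $$ (r, i) * T $$ (i, i)"
    by (rule mult_upper_triangular_index[OF _ T dims r])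
  also have "\<dots> = 0"
    using M diag * r dims by (cases "i = j") (auto simp: zero_cols_def)
  finally show "(M * T) $$ (r, i) = 0" .
qed

context radi_step begin

context
  fixes k :: nat and P N L :: "complex mat"
  assumes P: "P \<in> carrier_mat n k" and N: "N \<in> carrier_mat n k" and L: "L \<in> carrier_mat k k"
    and top: "A * P + G * N = P * L" and bottom: "Q * P - mat_adjoint A * N = N * L"
begin

lemma dims_PNL [simp]:
  "dim_row P = n" "dim_col P = k" "dim_row N = n" "dim_col N = k" "dim_row L = k" "dim_col L = k"
  using P N L by auto

lemma A_P: "A * P = P * L - B * (mat_adjoint B * N)"
  unfolding top[symmetric]
  by (simp add: mat_mult_assoc_dims) (rule eq_matI; simp del: index_mult_mat(1))

lemma adjA_N: "mat_adjoint A * N = Q * P - N * L"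
  unfolding bottom[symmetric] by (rule eq_matI; simp del: index_mult_mat(1))

text \<open>
  The defect \<open>X P + N\<close> measures how far the graph of \<open>- X\<close> is from containing the invariant subspace
  spanned by the columns of \<open>P\<close> stacked on \<open>N\<close>.  Up to factors on the left, which act on all columns
  alike, the defect of the half step times \<open>L + cnj s I\<close> is the defect of \<open>X\<close>, and the defect of \<open>X'\<close>
  is the defect of the half step times \<open>L - s I\<close>.
\<close>

lemma half_step_defect:
  "(Xh * P + N) * (L + cnj s \<cdot>\<^sub>m 1\<^sub>m k)
    = (Xh * G - mat_adjoint A + cnj s \<cdot>\<^sub>m 1\<^sub>m n) * (X * P + N)"
proof -
  \<comment> \<open>the half step is kept opaque, as only the ADI equation that it satisfies matters\<close>
  define Z where "Z = Xh"
  have [simp]: "dim_row Z = n" "dim_col Z = n" by (simp_all add: Z_def)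
  have "(Z * P + N) * (L + cnj s \<cdot>\<^sub>m 1\<^sub>m k) = Z * (P * L) + N * L + cnj s \<cdot>\<^sub>m (Z * P) + cnj s \<cdot>\<^sub>m N"
    by (simp add: mat_expand) (rule eq_matI; simp add: algebra_simps del: index_mult_mat(1))
  also have "\<dots> = (Z * (A + cnj s \<cdot>\<^sub>m 1\<^sub>m n - G * X)) * P + Z * (G * (X * P)) + Z * (G * N)
      + Q * P - mat_adjoint A * N + cnj s \<cdot>\<^sub>m N"
    unfolding top[symmetric] bottom[symmetric]
    by (simp add: mat_expand) (rule eq_matI; simp add: algebra_simps del: index_mult_mat(1))
  also have "\<dots> = (Z * G - mat_adjoint A + cnj s \<cdot>\<^sub>m 1\<^sub>m n) * (X * P + N)"
    unfolding half_step_eq[folded Z_def]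
    by (simp add: mat_expand) (rule eq_matI; simp add: algebra_simps del: index_mult_mat(1))
  finally show ?thesis unfolding Z_def .
qed

lemma full_step_defect:
  "Kh * (X' * P + N) = - ((Xh * P + N) * (L - s \<cdot>\<^sub>m 1\<^sub>m k))"
proof -
  \<comment> \<open>the half step is kept opaque, as only the ADI equation that it satisfies matters\<close>
  define Z where "Z = Xh"
  have [simp]: "dim_row Z = n" "dim_col Z = n" by (simp_all add: Z_def)
  have "Kh * (X' * P + N) = (Kh * X') * P + Kh * N"
    by (simp add: mat_mult_add_dims mat_mult_assoc_dims)
  also have "\<dots> = - ((Xh * P + N) * (L - s \<cdot>\<^sub>m 1\<^sub>m k))"
    unfolding full_step_eq unfolding Z_def[symmetric]
    apply (simp add: mat_expand adjA_N A_P)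
    apply (rule eq_matI; simp add: algebra_simps del: index_mult_mat(1))
    done
  finally show ?thesis .
qed

text \<open>
  The diagonal entries of \<open>L + cnj s I\<close> have negative real part, so the half step preserves the
  vanishing columns; in \<open>L - s I\<close> the diagonal entry at \<open>j\<close> is zero, so the full step annihilates one more.
\<close>

lemma defect_step:
  assumes ut: "upper_triangular L" and stableL: "\<And>i. i < k \<Longrightarrow> Re (L $$ (i, i)) < 0"
    and j: "j < k" "L $$ (j, j) = s" and zero: "zero_cols j (X * P + N)"
  shows "zero_cols (Suc j) (X' * P + N)"
proof -
  have T: "L + cnj s \<cdot>\<^sub>m 1\<^sub>m k \<in> carrier_mat k k" "L - s \<cdot>\<^sub>m 1\<^sub>m k \<in> carrier_mat k k"
    by (rule carrier_matI; simp)+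
  have ut': "upper_triangular (L + cnj s \<cdot>\<^sub>m 1\<^sub>m k)" "upper_triangular (L - s \<cdot>\<^sub>m 1\<^sub>m k)"
    using ut by (auto simp: upper_triangular_def)
  have "zero_cols j ((Xh * P + N) * (L + cnj s \<cdot>\<^sub>m 1\<^sub>m k))"
    unfolding half_step_defect by (rule zero_cols_mult_left[OF zero]) simp
  moreover have "(L + cnj s \<cdot>\<^sub>m 1\<^sub>m k) $$ (i, i) \<noteq> 0" if "i < k" for i
  proof
    assume "(L + cnj s \<cdot>\<^sub>m 1\<^sub>m k) $$ (i, i) = 0"
    then have "Re (L $$ (i, i)) + Re s = 0" using that by (simp add: complex_eq_iff)
    then show False using stableL[OF that] stable by simp
  qed
  ultimately have "zero_cols j (Xh * P + N)"
    by (rule zero_cols_cancel_triangular[OF _ T(1) ut'(1)]) simp_all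
  then have "zero_cols (Suc j) ((Xh * P + N) * (L - s \<cdot>\<^sub>m 1\<^sub>m k))"
    by (rule zero_cols_mult_triangular_Suc[OF _ T(2) ut'(2)]) (use j in simp_all)
  then have "zero_cols (Suc j) (minv Kh * - ((Xh * P + N) * (L - s \<cdot>\<^sub>m 1\<^sub>m k)))"
    using minv_inverse(1)[OF Kh_carrier Kh_invertible]
    by (intro zero_cols_mult_left) (auto simp: zero_cols_def simp del: index_mult_mat(1))
  then show ?thesis
    unfolding full_step_defect[symmetric]
    by (subst (asm) minv_mult_cancel(2)[OF Kh_carrier Kh_invertible]) simp_all
qed

end

text \<open>
  If \<open>R = r l\<close> has rank at most one, then so has \<open>V = v l\<close>, and \<open>l\<close> is a left eigenvector of \<open>Y\<close> and
  hence of \<open>Y\<^sup>-\<^sup>1\<close>.  Thus the row \<open>l\<close> is the same in all residual factors, and each step adds a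
  matrix of rank at most one to \<open>X\<close>.
\<close>

lemma rank_one_step:
  assumes r: "r \<in> carrier_mat n 1" and l: "l \<in> carrier_mat 1 p" and R_eq: "R = r * l"
  shows "\<exists>v\<in>carrier_mat n 1. \<exists>f\<in>carrier_mat 1 n. X' = X + v * f"
    and "\<exists>r'\<in>carrier_mat n 1. R' = r' * l"
proof -
  have [simp]: "dim_row r = n" "dim_col r = Suc 0" "dim_row l = Suc 0" "dim_col l = p" using r l by auto
  define v where "v = c \<cdot>\<^sub>m (minv K * r)"
  have [simp]: "dim_row v = n" "dim_col v = Suc 0" by (simp_all add: v_def)
  have "V = c \<cdot>\<^sub>m (minv K * (r * l))" unfolding R_eq[symmetric] by (rule V_eq)
  then have V: "V = v * l" by (simp add: v_def mat_expand)
  have scalar: "M * l = M $$ (0, 0) \<cdot>\<^sub>m l" if "M \<in> carrier_mat 1 1" for M :: "complex mat"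
    using that by (intro eq_matI) (auto simp: scalar_prod_def)
  define M where "M = 1\<^sub>m 1 + inverse (c * c) \<cdot>\<^sub>m ((l * mat_adjoint l) * (mat_adjoint v * (B * (mat_adjoint B * v))))"
  have M: "M \<in> carrier_mat 1 1" unfolding M_def by (rule carrier_matI) simp_all
  have "l * Y = M * l"
    unfolding Y_eq M_def unfolding V by (simp add: mat_expand mat_adjoint_expand)
  then have lY: "l * Y = M $$ (0, 0) \<cdot>\<^sub>m l" using scalar[OF M] by simp
  have "l = l * (Y * T)"
    by (simp only: minv_inverse(2)[OF Y_carrier Y_invertible]) (simp add: mat_mult_one_dims)
  also have "\<dots> = (l * Y) * T" by (rule mat_mult_assoc_dims[symmetric]) simp_all
  also have "\<dots> = M $$ (0, 0) \<cdot>\<^sub>m (l * T)" unfolding lY by (rule mat_smult_mult_dims) simp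
  finally have l_eq: "l = M $$ (0, 0) \<cdot>\<^sub>m (l * T)" .
  have "\<exists>t. l * T = t \<cdot>\<^sub>m l"
  \<comment> \<open>\<open>Y\<close> is invertible, so a zero eigenvalue occurs only if the row \<open>l\<close> is zero\<close>
  proof (cases "M $$ (0, 0) = 0")
    case True
    have "l = 0\<^sub>m 1 p" by (subst l_eq, rule eq_matI) (simp_all add: True del: index_mult_mat(1))
    then have "l * T = 0 \<cdot>\<^sub>m l" using T_carrier by (intro eq_matI) simp_all
    then show ?thesis ..
  next
    case False
    have "l * T = (1 / M $$ (0, 0)) \<cdot>\<^sub>m (M $$ (0, 0) \<cdot>\<^sub>m (l * T))"
      using False by (intro eq_matI) (simp_all del: index_mult_mat(1))
    then show ?thesis unfolding l_eq[symmetric] ..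
  qed
  then obtain t where t: "l * T = t \<cdot>\<^sub>m l" ..
  have "X' = X + v * (l * (T * mat_adjoint V))"
    unfolding next_eq by (subst V) (simp add: mat_expand)
  then show "\<exists>v\<in>carrier_mat n 1. \<exists>f\<in>carrier_mat 1 n. X' = X + v * f"
    by (intro bexI[of _ v] bexI[of _ "l * (T * mat_adjoint V)"]) (assumption | rule carrier_matI | simp)+
  have "R' = (r + (c * t) \<cdot>\<^sub>m v) * l"
  proof -
    have "V * T = v * (t \<cdot>\<^sub>m l)" unfolding t[symmetric] by (subst V) (simp add: mat_mult_assoc_dims)
    then have "R' = r * l + c \<cdot>\<^sub>m (v * (t \<cdot>\<^sub>m l))" using R_eq by simp
    then show ?thesis
      by (simp add: mat_expand) (rule eq_matI; simp add: algebra_simps del: index_mult_mat(1))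
  qed
  then show "\<exists>r'\<in>carrier_mat n 1. R' = r' * l"
    by (intro bexI[of _ "r + (c * t) \<cdot>\<^sub>m v"]) (assumption | rule carrier_matI | simp)+
qed

end

text \<open>
  All columns are multiples of one nonzero column, because two linearly independent columns would
  already give rank two.
\<close>

lemma rank_le_1_factor:
  assumes C: "(C :: complex mat) \<in> carrier_mat p n" and rank: "vec_space.rank p C \<le> 1"
  shows "\<exists>a\<in>carrier_mat p 1. \<exists>b\<in>carrier_mat 1 n. C = a * b"
proof (cases "\<exists>i<p. \<exists>j<n. C $$ (i, j) \<noteq> 0")
  case False
  then have "C = 0\<^sub>m p 1 * 0\<^sub>m 1 n" using C by (intro eq_matI) auto
  then show ?thesis by (rule rev_bexI[OF zero_carrier_mat rev_bexI[OF zero_carrier_mat]])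
next
  case True
  then obtain i0 j0 where ij0: "i0 < p" "j0 < n" "C $$ (i0, j0) \<noteq> 0" by blast
  interpret vec_space "TYPE(complex)" p .
  have [simp]: "dim_row C = p" "dim_col C = n" using C by auto
  have ex: "\<exists>t. \<forall>i<p. C $$ (i, j) = C $$ (i, j0) * t" if j: "j < n" for j
  proof (cases "col C j = col C j0")
    case True
    have "C $$ (i, j) = C $$ (i, j0)" if "i < p" for i
      using arg_cong[OF True, of "\<lambda>v. v $ i"] that j ij0 by simp
    then show ?thesis by (intro exI[of _ 1]) simp
  next
    case False
    define M where "M = mat_of_cols p [col C j0, col C j]"
    have M: "M \<in> carrier_mat p 2" by (rule carrier_matI) (simp_all add: M_def)
    have "col C j0 \<in> carrier_vec p" "col C j \<in> carrier_vec p"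
      by (rule carrier_vecI; simp)+
    then have cols: "cols M = [col C j0, col C j]"
      unfolding M_def by (intro cols_mat_of_cols) simp
    have "lin_dep (set (cols M))"
    proof (rule ccontr)
      assume "\<not> lin_dep (set (cols M))"
      moreover have "set (cols M) \<subseteq> set (cols C)"
        unfolding cols using C j ij0 by (auto simp: cols_def)
      ultimately have "card (set (cols M)) \<le> rank C"
        using rank_ge_card_indpt[OF C] by blast
      moreover have "card (set (cols M)) = 2" unfolding cols using False by simp
      ultimately show False using rank by simp
    qed
    moreover have "distinct (cols M)" unfolding cols using False by simp
    ultimately obtain v where v: "v \<in> carrier_vec 2" "v \<noteq> 0\<^sub>v 2" "M *\<^sub>v v = 0\<^sub>v p"
      using lin_depE[OF M] by blast
    have eq: "C $$ (i, j0) * v $ 0 + C $$ (i, j) * v $ 1 = 0" if "i < p" for i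
    proof -
      have "(M *\<^sub>v v) $ i = M $$ (i, 0) * v $ 0 + M $$ (i, 1) * v $ 1"
        using M v(1) that by (simp add: scalar_prod_def numeral_2_eq_2)
      moreover have "M $$ (i, 0) = C $$ (i, j0)" "M $$ (i, 1) = C $$ (i, j)"
        using that C j ij0 by (simp_all add: M_def mat_of_cols_index)
      ultimately show ?thesis using v(3) that by simp
    qed
    have "v $ 1 \<noteq> 0"
    proof
      assume v1: "v $ 1 = 0"
      then have "v $ 0 = 0" using eq[OF ij0(1)] ij0(3) by simp
      then have "v = 0\<^sub>v 2" using v1 v(1) by (intro eq_vecI) (auto simp: less_2_cases_iff)
      then show False using v(2) by simp
    qed
    have "C $$ (i, j) = C $$ (i, j0) * (- v $ 0 / v $ 1)" if "i < p" for i
    proof -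
      have "C $$ (i, j) * v $ 1 = - (C $$ (i, j0) * v $ 0)"
        using eq[OF that] by (simp add: eq_neg_iff_add_eq_0 add.commute)
      then show ?thesis using \<open>v $ 1 \<noteq> 0\<close> by (simp add: field_simps)
    qed
    then show ?thesis by blast
  qed
  then obtain t where t: "\<And>i j. i < p \<Longrightarrow> j < n \<Longrightarrow> C $$ (i, j) = C $$ (i, j0) * t j" by metis
  define a b where "a = mat p 1 (\<lambda>(i, j). C $$ (i, j0))" and "b = mat 1 n (\<lambda>(i, j). t j)"
  have "C = a * b"
    using C t by (intro eq_matI) (auto simp: a_def b_def scalar_prod_def)
  moreover have "a \<in> carrier_mat p 1" "b \<in> carrier_mat 1 n" by (simp_all add: a_def b_def)
  ultimately show ?thesis by (intro bexI[of _ a] bexI[of _ b])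
qed

text \<open>
  Let \<open>X = U F\<close> with inner dimension \<open>k\<close>.  Then \<open>S = - X P\<close> and \<open>S\<^sup>* = - P\<^sup>* X\<close> give
  \<open>S\<^sup>* P = - (P\<^sup>* U) (F P)\<close>, a product of \<open>k\<close> by \<open>k\<close> matrices; its invertibility makes both
  factors invertible, and in \<open>- S (S\<^sup>* P)\<^sup>-\<^sup>1 S\<^sup>*\<close> they cancel, leaving \<open>U F\<close>.
\<close>

lemma inv_approx_eq:
  assumes P: "P \<in> carrier_mat n k" and X: "X = U * F" and U: "U \<in> carrier_mat n k" and F: "F \<in> carrier_mat k n"
    and herm: "mat_adjoint X = X" and XP: "X * P = - S" and S: "S \<in> carrier_mat n k"
    and inv: "invertible_mat (mat_adjoint S * P)"
  shows "inv_approx P S = X"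
proof -
  have [simp]: "dim_row P = n" "dim_col P = k" "dim_row U = n" "dim_col U = k" "dim_row F = k" "dim_col F = n"
    "dim_row S = n" "dim_col S = k" using P U F S by auto
  define E1 E2 where "E1 = F * P" and "E2 = mat_adjoint P * U"
  have E: "E1 \<in> carrier_mat k k" "E2 \<in> carrier_mat k k" unfolding E1_def E2_def by (rule carrier_matI; simp)+
  then have [simp]: "dim_row E1 = k" "dim_col E1 = k" "dim_row E2 = k" "dim_col E2 = k" by auto
  have "S = - (X * P)" unfolding XP by simp
  then have S_eq: "S = - (U * E1)" unfolding X E1_def by (simp add: mat_mult_assoc_dims)
  have "mat_adjoint S = - (mat_adjoint P * X)"
    using \<open>S = - (X * P)\<close> herm by (simp add: mat_adjoint_expand X)
  then have S_adj: "mat_adjoint S = - (E2 * F)" unfolding X E2_def by (simp add: mat_mult_assoc_dims)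
  have prod: "mat_adjoint S * P = - (E2 * E1)"
    unfolding S_adj E1_def by (simp add: mat_expand)
  have c: "mat_adjoint S * P \<in> carrier_mat k k" by (rule carrier_matI) simp_all
  have "det (- (E2 * E1)) \<noteq> 0"
    using inv invertible_mat_iff_det[OF c] unfolding prod by simp
  moreover have "- (E2 * E1) = ((- 1) \<cdot>\<^sub>m E2) * E1" by (rule eq_matI) simp_all
  moreover have "det (((- 1) \<cdot>\<^sub>m E2) * E1) = (- 1) ^ k * det E2 * det E1"
    using E by (subst det_mult[of _ k]) simp_all
  ultimately have "det E1 \<noteq> 0" "det E2 \<noteq> 0" by auto
  then have "invertible_mat E1" "invertible_mat E2"
    using invertible_mat_iff_det E by blast+
  note i = minv_inverse[OF E(1) this(1)] minv_inverse[OF E(2) this(2)]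
    and cancel = minv_mult_cancel[OF E(1) this(1)] minv_mult_cancel[OF E(2) this(2)]
  have [simp]: "dim_row (minv E1) = k" "dim_col (minv E1) = k" "dim_row (minv E2) = k" "dim_col (minv E2) = k"
    using i by auto
  have "minv (mat_adjoint S * P) = - (minv E1 * minv E2)"
    unfolding prod by (rule minv_unique[of _ k])
      (rule carrier_matI | simp add: mat_expand cancel i)+
  then show ?thesis
    unfolding inv_approx_def S_adj X
    by (simp add: S_eq mat_expand cancel)
qed

section \<open>Comparison of the four methods\<close>

lemma radi_approx_0: "A \<in> carrier_mat n n \<Longrightarrow> radi_approx A B C \<sigma> 0 = 0\<^sub>m n n"
  by (simp add: radi_approx_def radi_X_empty)

lemma radi_eq_adi_cayley:
  assumes A: "A \<in> carrier_mat n n" and B: "B \<in> carrier_mat n m" and C: "C \<in> carrier_mat p n"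
    and shifts: "\<And>j. j \<ge> 1 \<Longrightarrow> Re (\<sigma> j) < 0"
    and defined: "radi_defined A B C \<sigma> k"
  defines "G \<equiv> B * mat_adjoint B" and "Q \<equiv> mat_adjoint C * C"
  shows "adi_approx A G Q \<sigma> k = radi_approx A B C \<sigma> k"
    and "cayley_approx n (four_block_mat A G Q (- mat_adjoint A)) \<sigma> k = radi_approx A B C \<sigma> k"
proof -
  have "adi_approx A G Q \<sigma> j = radi_approx A B C \<sigma> j \<and>
      cayley_approx n (four_block_mat A G Q (- mat_adjoint A)) \<sigma> j = radi_approx A B C \<sigma> j" if "j \<le> k" for j
    using that
  proof (induction j)
    case 0
    then show ?case using A by (simp add: radi_approx_0)
  next
    case (Suc j)
    then have j: "j < k" by simp
    interpret radi_step n m p A B "mat_adjoint C * C" "radi_approx A B C \<sigma> j" "radi_R A B C \<sigma> j" "\<sigma> (Suc j)"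
      by (rule radi_run(2)[OF A B C shifts defined j])
    have approx_Suc: "radi_approx A B C \<sigma> (Suc j) = X'"
      by (rule radi_run(3)[OF assms(1-3) shifts defined j])
    show ?case
      using Suc adi_step cayley_step
      unfolding approx_Suc G_def Q_def by simp
  qed
  then show "adi_approx A G Q \<sigma> k = radi_approx A B C \<sigma> k"
    "cayley_approx n (four_block_mat A G Q (- mat_adjoint A)) \<sigma> k = radi_approx A B C \<sigma> k" by simp_all
qed

lemma radi_approx_low_rank:
  assumes A: "A \<in> carrier_mat n n" and B: "B \<in> carrier_mat n m" and C: "C \<in> carrier_mat p n"
    and shifts: "\<And>j. j \<ge> 1 \<Longrightarrow> Re (\<sigma> j) < 0"
    and defined: "radi_defined A B C \<sigma> k" and rank: "vec_space.rank p C \<le> 1"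
  shows "\<exists>U\<in>carrier_mat n k. \<exists>F\<in>carrier_mat k n. radi_approx A B C \<sigma> k = U * F"
proof -
  obtain a b where a: "a \<in> carrier_mat p 1" and b: "b \<in> carrier_mat 1 n" and C_eq: "C = a * b"
    using rank_le_1_factor[OF C rank] by blast
  define l where "l = mat_adjoint a"
  have l: "l \<in> carrier_mat 1 p" using a by (simp add: l_def)
  have "(\<exists>U\<in>carrier_mat n j. \<exists>F\<in>carrier_mat j n. radi_approx A B C \<sigma> j = U * F) \<and>
      (\<exists>r\<in>carrier_mat n 1. radi_R A B C \<sigma> j = r * l)" if "j \<le> k" for j
    using that
  proof (induction j)
    case 0
    have "radi_approx A B C \<sigma> 0 = 0\<^sub>m n 0 * 0\<^sub>m 0 n"
      unfolding radi_approx_0[OF A] by (rule eq_matI) (simp_all add: scalar_prod_def)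
    moreover have "radi_R A B C \<sigma> 0 = mat_adjoint b * l"
      using a b by (simp add: radi_R_def C_eq l_def mat_adjoint_mult)
    moreover have "mat_adjoint b \<in> carrier_mat n 1" using b by simp
    ultimately show ?case
      by (intro conjI bexI[of _ "0\<^sub>m n 0"] bexI[of _ "0\<^sub>m 0 n"] bexI[of _ "mat_adjoint b"]) simp_all
  next
    case (Suc j)
    then have j: "j < k" by simp
    interpret radi_step n m p A B "mat_adjoint C * C" "radi_approx A B C \<sigma> j" "radi_R A B C \<sigma> j" "\<sigma> (Suc j)"
      by (rule radi_run(2)[OF A B C shifts defined j])
    have approx_Suc: "radi_approx A B C \<sigma> (Suc j) = X'"
      by (rule radi_run(3)[OF assms(1-3) shifts defined j])
    obtain U F r where U: "U \<in> carrier_mat n j" and F: "F \<in> carrier_mat j n"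
      and UF: "radi_approx A B C \<sigma> j = U * F" and r: "r \<in> carrier_mat n 1" "radi_R A B C \<sigma> j = r * l"
      using Suc by auto
    obtain v f where v: "v \<in> carrier_mat n 1" and f: "f \<in> carrier_mat 1 n"
      and next': "X' = radi_approx A B C \<sigma> j + v * f"
      using rank_one_step(1)[OF r(1) l r(2)] by blast
    have "radi_approx A B C \<sigma> (Suc j) = radi_approx A B C \<sigma> j + v * f"
      unfolding approx_Suc by (rule next')
    also have "\<dots> = U * F + v * f" unfolding UF ..
    also have "\<dots> = append_cols U v * (F @\<^sub>r f)"
      by (rule append_cols_mult_append_rows[OF U v F f, symmetric])
    finally have "radi_approx A B C \<sigma> (Suc j) = append_cols U v * (F @\<^sub>r f)" .
    moreover have "append_cols U v \<in> carrier_mat n (Suc j)" "F @\<^sub>r f \<in> carrier_mat (Suc j) n"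
      using U v F f by (auto intro!: carrier_matI simp: append_cols_def)
    moreover have "radi_R A B C \<sigma> (Suc j) = R'"
      using radi_run(4)[OF assms(1-3) shifts defined j] unfolding Let_def c_def .
    moreover obtain r' where "r' \<in> carrier_mat n 1" "R' = r' * l"
      using rank_one_step(2)[OF r(1) l r(2)] by blast
    ultimately show ?case
      by (intro conjI bexI[of _ "append_cols U v"] bexI[of _ "F @\<^sub>r f"] bexI[of _ r']) simp_all
  qed
  then show ?thesis by simp
qed

text \<open>
  As \<open>\<Lambda>\<close> is of size \<open>k\<close> and has \<open>k\<close> distinct eigenvalues, its characteristic polynomial is the
  product of the corresponding linear factors, in any order.  The Schur form can therefore be
  chosen with the shifts on the diagonal in the order in which the iteration uses them.
\<close>

lemma triangularize_distinct_spectrum: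
  assumes L: "(L :: complex mat) \<in> carrier_mat k k" and spec: "spectrum L = \<sigma> ` {1..k}" and inj: "inj_on \<sigma> {1..k}"
  shows "\<exists>T W. T \<in> carrier_mat k k \<and> W \<in> carrier_mat k k \<and> invertible_mat W \<and> L * W = W * T \<and>
    upper_triangular T \<and> (\<forall>i<k. T $$ (i, i) = \<sigma> (Suc i))"
proof -
  define es where "es = map \<sigma> [1..<Suc k]"
  have set_es: "set es = spectrum L" unfolding es_def spec by (simp add: atLeastLessThanSuc_atLeastAtMost del: upt_Suc)
  have "distinct es"
    unfolding es_def distinct_map using inj by (simp add: atLeastLessThanSuc_atLeastAtMost del: upt_Suc)
  obtain as where as: "char_poly L = (\<Prod>a\<leftarrow>as. [:- a, 1:])" and len: "length as = k"
    using char_poly_factorized[OF L] by blast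
  have "poly (\<Prod>a\<leftarrow>as. [:- a, 1:]) x = 0 \<longleftrightarrow> x \<in> set as" for x
    by (induction as) auto
  then have set_as: "set as = set es"
    unfolding set_es spectrum_def using eigenvalue_root_char_poly[OF L] as by auto
  have "card (set as) = length as"
    unfolding set_as len distinct_card[OF \<open>distinct es\<close>] by (simp add: es_def)
  then have "distinct as" by (rule card_distinct)
  then have "mset as = mset es"
    using \<open>distinct es\<close> set_as by (simp add: set_eq_iff_mset_eq_distinct)
  then have "mset (map (\<lambda>a. [:- a, 1:]) as) = mset (map (\<lambda>a. [:- a, 1:]) es)" by simp
  then have "(\<Prod>a\<leftarrow>as. [:- a, 1:]) = (\<Prod>a\<leftarrow>es. [:- a, 1:])"
    by (metis prod_mset_prod_list)
  then have cp: "char_poly L = (\<Prod>a\<leftarrow>es. [:- a, 1:])" using as by simp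
  obtain T W Wi where "schur_decomposition L es = (T, W, Wi)" by (metis prod_cases3)
  then have sim: "similar_mat_wit L T W Wi" and ut: "upper_triangular T" and diag: "diag_mat T = es"
    using schur_decomposition[OF L cp] by auto
  from similar_mat_witD2[OF L sim] have c: "T \<in> carrier_mat k k" "W \<in> carrier_mat k k" "Wi \<in> carrier_mat k k"
    and eq: "W * Wi = 1\<^sub>m k" "Wi * W = 1\<^sub>m k" "L = W * T * Wi" by auto
  have dims: "dim_row T = k" "dim_col T = k" "dim_row W = k" "dim_col W = k" "dim_row Wi = k" "dim_col Wi = k"
    using c by auto
  have "L * W = W * (T * (Wi * W))" unfolding eq(3) by (simp add: mat_mult_assoc_dims dims)
  then have LW: "L * W = W * T" unfolding eq(2) by (simp add: mat_mult_one_dims dims)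
  have "T $$ (i, i) = \<sigma> (Suc i)" if "i < k" for i
    using arg_cong[OF diag, of "\<lambda>xs. xs ! i"] that dims by (simp add: diag_mat_def es_def del: upt_Suc)
  then show ?thesis
    using c ut LW invertible_mat_rightI[OF c(2,3) eq(1)] by (intro exI[of _ T] exI[of _ W]) simp
qed

lemma append_rows_inject:
  assumes "P @\<^sub>r N = P' @\<^sub>r N'" "dim_row P = dim_row P'" "dim_row N = dim_row N'"
    "dim_col P = dim_col N" "dim_col P' = dim_col P" "dim_col N' = dim_col N"
  shows "P = P'" "N = (N' :: complex mat)"
proof -
  have eq: "(P @\<^sub>r N) $$ (i, j) = (P' @\<^sub>r N') $$ (i, j)" for i j using assms(1) by simp
  have "P $$ (i, j) = P' $$ (i, j)" if "i < dim_row P" "j < dim_col P" for i j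
    using eq[of i j] assms(2-) that by simp
  then show "P = P'" using assms(2-) by (intro eq_matI) simp_all
  have "N $$ (i, j) = N' $$ (i, j)" if "i < dim_row N" "j < dim_col N" for i j
    using eq[of "dim_row P + i" j] assms(2-) that by simp
  then show "N = N'" using assms(2-) by (intro eq_matI) simp_all
qed

text \<open>
  After \<open>j\<close> steps the first \<open>j\<close> columns of the defect have been annihilated, in the basis in which
  \<open>L\<close> is triangular.  After \<open>k\<close> steps the defect is zero, so the graph of \<open>- X\<close> contains the whole
  invariant subspace.
\<close>

lemma radi_annihilates_stable_subspace:
  assumes A: "A \<in> carrier_mat n n" and B: "B \<in> carrier_mat n m" and C: "C \<in> carrier_mat p n"
    and shifts: "\<And>j. j \<ge> 1 \<Longrightarrow> Re (\<sigma> j) < 0"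
    and defined: "radi_defined A B C \<sigma> k"
    and P: "P \<in> carrier_mat n k" and N: "N \<in> carrier_mat n k" and L: "L \<in> carrier_mat k k"
    and invariant: "four_block_mat A (B * mat_adjoint B) (mat_adjoint C * C) (- mat_adjoint A) * (P @\<^sub>r N)
      = (P @\<^sub>r N) * L"
    and spec: "spectrum L = \<sigma> ` {1..k}" and inj: "inj_on \<sigma> {1..k}"
  shows "radi_approx A B C \<sigma> k * P = - N"
proof -
  let ?G = "B * mat_adjoint B" and ?Q = "mat_adjoint C * C"
  have [simp]: "dim_row A = n" "dim_col A = n" "dim_row B = n" "dim_col B = m" "dim_row C = p" "dim_col C = n"
    "dim_row P = n" "dim_col P = k" "dim_row N = n" "dim_col N = k" "dim_row L = k" "dim_col L = k"
    using A B C P N L by auto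
  have G: "?G \<in> carrier_mat n n" and Q: "?Q \<in> carrier_mat n n" and A': "- mat_adjoint A \<in> carrier_mat n n"
    by (rule carrier_matI; simp)+
  have "(A * P + ?G * N) @\<^sub>r (?Q * P + - mat_adjoint A * N) = (P * L) @\<^sub>r (N * L)"
    using invariant unfolding four_block_mult_append_rows[OF A G Q A' P N]
    by (simp add: append_rows_mult)
  from append_rows_inject[OF this]
  have top: "A * P + ?G * N = P * L" and bottom': "?Q * P + - mat_adjoint A * N = N * L" by simp_all
  have bottom: "?Q * P - mat_adjoint A * N = N * L"
    unfolding bottom'[symmetric] by (simp add: mat_uminus_mult_dims) (rule eq_matI; simp del: index_mult_mat(1))
  obtain T W where T: "T \<in> carrier_mat k k" and W: "W \<in> carrier_mat k k" "invertible_mat W"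
    and LW: "L * W = W * T" and ut: "upper_triangular T" and diag: "\<And>i. i < k \<Longrightarrow> T $$ (i, i) = \<sigma> (Suc i)"
    using triangularize_distinct_spectrum[OF L spec inj] by blast
  have [simp]: "dim_row T = k" "dim_col T = k" "dim_row W = k" "dim_col W = k" using T W by auto
  have PW: "P * W \<in> carrier_mat n k" "N * W \<in> carrier_mat n k" by (rule carrier_matI; simp)+
  have top': "A * (P * W) + ?G * (N * W) = (P * W) * T"
    using arg_cong[OF top, of "\<lambda>M. M * W"] by (simp add: mat_expand LW)
  have bottom'': "?Q * (P * W) - mat_adjoint A * (N * W) = (N * W) * T"
    using arg_cong[OF bottom, of "\<lambda>M. M * W"] by (simp add: mat_expand LW)
  have "zero_cols j (radi_approx A B C \<sigma> j * (P * W) + N * W)" if "j \<le> k" for j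
    using that
  proof (induction j)
    case 0
    then show ?case by (simp add: zero_cols_def)
  next
    case (Suc j)
    then have j: "j < k" by simp
    interpret radi_step n m p A B "mat_adjoint C * C" "radi_approx A B C \<sigma> j" "radi_R A B C \<sigma> j" "\<sigma> (Suc j)"
      by (rule radi_run(2)[OF A B C shifts defined j])
    have approx_Suc: "radi_approx A B C \<sigma> (Suc j) = X'"
      by (rule radi_run(3)[OF assms(1-3) shifts defined j])
    show ?case
      unfolding approx_Suc
      using Suc j by (intro defect_step[OF PW T top' bottom'' ut]) (simp_all add: diag shifts)
  qed
  then have zero: "zero_cols k (radi_approx A B C \<sigma> k * (P * W) + N * W)" by simp
  have X: "dim_row (radi_approx A B C \<sigma> k) = n" "dim_col (radi_approx A B C \<sigma> k) = n"
    using radi_run(1)[OF A B C shifts defined] by (auto simp: radi_approx_def)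
  have "(radi_approx A B C \<sigma> k * P + N) * W = radi_approx A B C \<sigma> k * (P * W) + N * W"
    by (simp add: mat_expand X)
  also have "\<dots> = 0\<^sub>m n k"
    using zero X by (intro eq_matI) (simp_all add: zero_cols_def del: index_mult_mat(1))
  also have "\<dots> = 0\<^sub>m n k * W" using left_mult_zero_mat[OF W(1)] by simp
  finally have "radi_approx A B C \<sigma> k * P + N = 0\<^sub>m n k"
    by (rule mat_mult_right_cancel[OF W, rotated 2]) (simp_all add: X)
  then have eq: "(radi_approx A B C \<sigma> k * P + N) $$ (i, j) = 0\<^sub>m n k $$ (i, j)" for i j by simp
  show ?thesis
  proof (rule eq_matI)
    fix i j assume "i < dim_row (- N)" "j < dim_col (- N)"
    then show "(radi_approx A B C \<sigma> k * P) $$ (i, j) = (- N) $$ (i, j)"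
      using eq[of i j] X by (simp add: eq_neg_iff_add_eq_0 del: index_mult_mat(1))
  qed (simp_all add: X)
qed

theorem theorem2:
  fixes n m p :: nat
    and A B C G Q H :: "complex mat"
    and \<sigma> :: "nat \<Rightarrow> complex"
  assumes A: "A \<in> carrier_mat n n" "elements_mat A \<subseteq> \<real>"
    and B: "B \<in> carrier_mat n m" "elements_mat B \<subseteq> \<real>"
    and C: "C \<in> carrier_mat p n" "elements_mat C \<subseteq> \<real>"
    and G: "G = B * mat_adjoint B"
    and Q: "Q = mat_adjoint C * C"
    and H: "H = four_block_mat A G Q (- mat_adjoint A)"
    and stab: "stabilizable A G"
    and det: "detectable A Q"
    and shifts: "\<And>j. j \<ge> 1 \<Longrightarrow> Re (\<sigma> j) < 0"
  shows
    "(\<forall>k. radi_defined A B C \<sigma> k \<longrightarrow>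
        radi_approx A B C \<sigma> k = adi_approx A G Q \<sigma> k \<and>
        adi_approx A G Q \<sigma> k = cayley_approx n H \<sigma> k) \<and>
     (vec_space.rank p C = 1 \<longrightarrow>
        (\<forall>k\<in>{1..n}. \<forall>P\<^sub>k Q\<^sub>k \<Lambda>\<^sub>k.
           radi_defined A B C \<sigma> k \<longrightarrow>
           (\<forall>j\<in>{1..k}. eigenvalue H (\<sigma> j)) \<longrightarrow> inj_on \<sigma> {1..k} \<longrightarrow>
           stable_invariant_basis n k H P\<^sub>k Q\<^sub>k \<Lambda>\<^sub>k \<longrightarrow>
           spectrum \<Lambda>\<^sub>k = \<sigma> ` {1..k} \<longrightarrow>
           invertible_mat (mat_adjoint Q\<^sub>k * P\<^sub>k) \<longrightarrow>
           radi_approx A B C \<sigma> k = adi_approx A G Q \<sigma> k \<and>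
           adi_approx A G Q \<sigma> k = cayley_approx n H \<sigma> k \<and>
           cayley_approx n H \<sigma> k = inv_approx P\<^sub>k Q\<^sub>k))"
proof -
  have eq: "adi_approx A G Q \<sigma> k = radi_approx A B C \<sigma> k" "cayley_approx n H \<sigma> k = radi_approx A B C \<sigma> k"
    if "radi_defined A B C \<sigma> k" for k
    using radi_eq_adi_cayley[OF A(1) B(1) C(1) shifts that] unfolding G Q H by simp_all
  have inv: "inv_approx P N = radi_approx A B C \<sigma> k"
    if rank: "vec_space.rank p C = 1" and defined: "radi_defined A B C \<sigma> k" and inj: "inj_on \<sigma> {1..k}"
      and basis: "stable_invariant_basis n k H P N L" and spec: "spectrum L = \<sigma> ` {1..k}"
      and regular: "invertible_mat (mat_adjoint N * P)" for k P N L
  proof -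
    from basis have P: "P \<in> carrier_mat n k" and N: "N \<in> carrier_mat n k" and L: "L \<in> carrier_mat k k"
      and inv: "H * (P @\<^sub>r N) = (P @\<^sub>r N) * L"
      unfolding stable_invariant_basis_def by blast+
    obtain U F where U: "U \<in> carrier_mat n k" and F: "F \<in> carrier_mat k n" and UF: "radi_approx A B C \<sigma> k = U * F"
      using radi_approx_low_rank[OF A(1) B(1) C(1) shifts defined] rank by auto
    have herm: "mat_adjoint (radi_approx A B C \<sigma> k) = radi_approx A B C \<sigma> k"
      using radi_run(1)[OF A(1) B(1) C(1) shifts defined] by (auto simp: radi_approx_def)
    have "radi_approx A B C \<sigma> k * P = - N"
      by (rule radi_annihilates_stable_subspace[OF A(1) B(1) C(1) shifts defined P N L
            inv[unfolded H G Q] spec inj])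
    then show ?thesis by (rule inv_approx_eq[OF P UF U F herm _ N regular])
  qed
  show ?thesis using eq inv by auto
qed

end
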